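(* Let $d\ge 2$. For all norms $\|\cdot\|$ on $\mathbb{R}^d$ besides a meagre set, the following holds: for every integer $n\ge 1$ and every set of $n$ distinct points in $\mathbb{R}^d$, the number of unit distances according to $\|\cdot\|$ among the $n$ points (i.e. the number of unordered pairs $\{\mathbf{p},\mathbf{q}\}$ of these points with $\|\mathbf{p}-\mathbf{q}\|=1$) is at most $\frac{d}{2}\cdot n\log_2 n$. Equivalently, $U_{\|\cdot\|}(n)\le \frac d2\cdot n\log_2 n$ for all $n\ge 1$.
   Context: A $d$-norm is a norm on $\mathbb{R}^d$. For a $d$-norm $\|\cdot\|$, $U_{\|\cdot\|}(n)$ denotes the maximum, over all sets of $n$ distinct points in $\mathbb{R}^d$, of the number of unordered pairs of these points at distance exactly $1$ according to $\|\cdot\|$. Let $\mathcal{B}_d$ be the set of all closed, bounded, $\mathbf{0}$-symmetric convex bodies in $\mathbb{R}^d$ containing $\mathbf{0}$ in the interior. The map sending a norm $\|\cdot\|$ to its unit ball $\{\mathbf{x}\in\mathbb{R}^d: \|\mathbf{x}\|\le 1\}$ is a bijection between $d$-norms and $\mathcal{B}_d$. The set $\mathcal{B}_d$ is endowed with the Hausdorff metric $d_H(A,B)=\max\{\sup_{\mathbf{a}\in A}\inf_{\mathbf{b}\in B}\|\mathbf{a}-\mathbf{b}\|_2,\ \sup_{\mathbf{b}\in B}\inf_{\mathbf{a}\in A}\|\mathbf{a}-\mathbf{b}\|_2\}$, where $\|\cdot\|_2$ is the Euclidean norm. A set in a metric space is nowhere dense if every non-empty open set contains a non-empty open subset disjoint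 from it; a meagre set is a countable union of nowhere dense sets. A property holds for all $d$-norms besides a meagre set if the set of unit balls of the $d$-norms failing the property is a meagre set in $(\mathcal{B}_d,d_H)$. *)

theory Defs
  imports "HOL-Analysis.Analysis"
begin

text \<open>The dimension $d$ is \<open>CARD('n)\<close>; on \<open>real ^ 'n\<close> the library's \<^const>\<open>norm\<close> is
  the Euclidean norm, and an arbitrary norm is a function \<open>N\<close> satisfying the norm axioms.\<close>

definition is_norm :: "(real ^ 'n \<Rightarrow> real) \<Rightarrow> bool" where
  "is_norm N \<longleftrightarrow>
     (\<forall>x. 0 \<le> N x) \<and> (\<forall>x. N x = 0 \<longleftrightarrow> x = 0) \<and>
     (\<forall>c x. N (c *\<^sub>R x) = \<bar>c\<bar> * N x) \<and> (\<forall>x y. N (x + y) \<le> N x + N y)"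

definition unit_ball :: "(real ^ 'n \<Rightarrow> real) \<Rightarrow> (real ^ 'n) set" where
  "unit_ball N = {x. N x \<le> 1}"

definition sym_bodies :: "(real ^ 'n) set set" where
  "sym_bodies = {K. closed K \<and> bounded K \<and> convex K \<and> (\<forall>x\<in>K. - x \<in> K) \<and> 0 \<in> interior K}"

definition hausdorff_dist :: "(real ^ 'n) set \<Rightarrow> (real ^ 'n) set \<Rightarrow> real" where
  "hausdorff_dist A B =
     max (SUP a\<in>A. INF b\<in>B. norm (a - b)) (SUP b\<in>B. INF a\<in>A. norm (a - b))"

text \<open>The locale \<^locale>\<open>Metric_space\<close> demands non-negativity and symmetry also outside the
  carrier, where suprema of unbounded or empty sets of reals are unspecified. The Hausdorff
  distance is therefore replaced by 0 there, which does not affect the topology on the carrier.\<close>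

definition body_dist :: "(real ^ 'n) set \<Rightarrow> (real ^ 'n) set \<Rightarrow> real" where
  "body_dist A B = (if A \<in> sym_bodies \<and> B \<in> sym_bodies then hausdorff_dist A B else 0)"

definition body_topology :: "(real ^ 'n) set topology" where
  "body_topology = Metric_space.mtopology sym_bodies body_dist"

definition nowhere_dense_in :: "'a topology \<Rightarrow> 'a set \<Rightarrow> bool" where
  "nowhere_dense_in X S \<longleftrightarrow> S \<subseteq> topspace X \<and>
     (\<forall>U. openin X U \<and> U \<noteq> {} \<longrightarrow> (\<exists>V. openin X V \<and> V \<noteq> {} \<and> V \<subseteq> U \<and> V \<inter> S = {}))"

definition meagre_in :: "'a topology \<Rightarrow> 'a set \<Rightarrow> bool" where
  "meagre_in X S \<longleftrightarrow> (\<exists>\<F>. countable \<F> \<and> (\<forall>T\<in>\<F>. nowhere_dense_in X T) \<and> S = \<Union>\<F>)"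

definition all_norms_besides_meagre :: "((real ^ 'n \<Rightarrow> real) \<Rightarrow> bool) \<Rightarrow> bool" where
  "all_norms_besides_meagre Q \<longleftrightarrow>
     meagre_in body_topology (unit_ball ` {N. is_norm N \<and> \<not> Q N})"

definition unit_distances :: "(real ^ 'n \<Rightarrow> real) \<Rightarrow> (real ^ 'n) set \<Rightarrow> nat" where
  "unit_distances N P = card {{p, q} | p q. p \<in> P \<and> q \<in> P \<and> p \<noteq> q \<and> N (p - q) = 1}"

definition max_unit_distances :: "(real ^ 'n \<Rightarrow> real) \<Rightarrow> nat \<Rightarrow> nat" where
  "max_unit_distances N n = Max {unit_distances N P | P. finite P \<and> card P = n}"

lemma finite_unit_distances:
  fixes N :: "real ^ 'n \<Rightarrow> real"
  shows "finite {unit_distances N P | P. finite P \<and> card P = n}"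
proof (rule finite_subset)
  show "{unit_distances N P | P. finite P \<and> card P = n} \<subseteq> {..2 ^ n}"
  proof clarsimp
    fix P :: "(real ^ 'n) set"
    assume P: "finite P" "n = card P"
    have "unit_distances N P \<le> card (Pow P)"
      unfolding unit_distances_def by (rule card_mono) (use P in auto)
    then show "unit_distances N P \<le> 2 ^ card P"
      using P by (simp add: card_Pow)
  qed
qed simp

text \<open>The maximum is taken over a finite non-empty set, so \<^const>\<open>Max\<close> is not degenerate.\<close>

lemma max_unit_distances_le_iff:
  fixes N :: "real ^ 'n \<Rightarrow> real"
  shows "real (max_unit_distances N n) \<le> c \<longleftrightarrow>
           (\<forall>P. finite P \<and> card P = n \<longrightarrow> real (unit_distances N P) \<le> c)"
proof -
  let ?S = "{unit_distances N P | P. finite P \<and> card P = n}"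
  have "infinite (UNIV :: (real ^ 'n) set)"
    using not_bounded_UNIV finite_imp_bounded by blast
  then obtain P :: "(real ^ 'n) set" where "finite P" "card P = n"
    using infinite_arbitrarily_large by blast
  then have "?S \<noteq> {}" by blast
  then have "max_unit_distances N n \<in> ?S"
    unfolding max_unit_distances_def by (intro Max_in finite_unit_distances)
  moreover have "unit_distances N P \<le> max_unit_distances N n" if "finite P" "card P = n" for P
    unfolding max_unit_distances_def by (rule Max_ge) (use that finite_unit_distances in auto)
  ultimately show ?thesis
    by (auto intro: order_trans of_nat_mono)
qed

lemma hausdorff_dist_infdist:
  assumes "A \<noteq> {}" "B \<noteq> {}"
  shows "hausdorff_dist A B = max (SUP a\<in>A. infdist a B) (SUP b\<in>B. infdist b A)"
  using assms by (simp add: hausdorff_dist_def infdist_def dist_norm norm_minus_commute)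

lemma sym_bodiesD:
  assumes "K \<in> sym_bodies"
  shows "compact K" "K \<noteq> {}" "closed K"
  using assms interior_subset[of K] by (auto simp: sym_bodies_def compact_eq_bounded_closed)

lemma infdist_le_hausdorff_dist:
  assumes "A \<in> sym_bodies" "B \<in> sym_bodies"
  shows "a \<in> A \<Longrightarrow> infdist a B \<le> hausdorff_dist A B"
    and "b \<in> B \<Longrightarrow> infdist b A \<le> hausdorff_dist A B"
proof -
  have bdd: "bdd_above ((\<lambda>a. infdist a L) ` K)" if "compact K" for K L :: "(real ^ 'n) set"
    by (intro bounded_imp_bdd_above compact_imp_bounded compact_continuous_image that)
       (intro continuous_intros)
  note eq = hausdorff_dist_infdist[OF sym_bodiesD(2)[OF assms(1)] sym_bodiesD(2)[OF assms(2)]]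
  show "infdist a B \<le> hausdorff_dist A B" if "a \<in> A"
    unfolding eq using that
    by (intro max.coboundedI1 cSUP_upper bdd sym_bodiesD assms)
  show "infdist b A \<le> hausdorff_dist A B" if "b \<in> B"
    unfolding eq using that
    by (intro max.coboundedI2 cSUP_upper bdd sym_bodiesD assms)
qed

lemma hausdorff_dist_leI:
  assumes "A \<in> sym_bodies" "B \<in> sym_bodies"
    and "\<And>a. a \<in> A \<Longrightarrow> infdist a B \<le> r" "\<And>b. b \<in> B \<Longrightarrow> infdist b A \<le> r"
  shows "hausdorff_dist A B \<le> r"
  using assms sym_bodiesD(2)[OF assms(1)] sym_bodiesD(2)[OF assms(2)]
  by (auto simp: hausdorff_dist_infdist intro!: cSUP_least)

lemma infdist_triangle_hausdorff:
  assumes A: "A \<in> sym_bodies" and B: "B \<in> sym_bodies" and le: "\<And>a. a \<in> A \<Longrightarrow> infdist a B \<le> s"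
    and x: "infdist x A \<le> r"
  shows "infdist x B \<le> r + s"
proof -
  obtain a where "a \<in> A" "infdist x A = dist x a"
    using infdist_attains_inf sym_bodiesD A by metis
  then show ?thesis
    using infdist_triangle[of x B a] le[of a] x by linarith
qed

lemma Metric_space_sym_bodies: "Metric_space sym_bodies body_dist"
proof
  show "0 \<le> body_dist A B" for A B :: "(real ^ 'n) set"
  proof -
    have "0 \<le> hausdorff_dist A B" if "A \<in> sym_bodies" "B \<in> sym_bodies"
      using infdist_le_hausdorff_dist(1)[OF that] sym_bodiesD(2)[OF that(1)] infdist_nonneg
      by (meson all_not_in_conv order_trans)
    then show ?thesis by (simp add: body_dist_def)
  qed
  show "body_dist A B = body_dist B A" for A B :: "(real ^ 'n) set"
    by (auto simp: body_dist_def hausdorff_dist_def max.commute norm_minus_commute)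
  show "body_dist A B = 0 \<longleftrightarrow> A = B"
    if AB: "A \<in> sym_bodies" "B \<in> sym_bodies" for A B :: "(real ^ 'n) set"
  proof
    assume "body_dist A B = 0"
    then have h: "hausdorff_dist A B = 0" using AB by (simp add: body_dist_def)
    have "a \<in> B" if "a \<in> A" for a
      using infdist_le_hausdorff_dist(1)[OF AB that] h infdist_nonneg[of a B] AB
      by (simp add: in_closed_iff_infdist_zero sym_bodiesD)
    moreover have "b \<in> A" if "b \<in> B" for b
      using infdist_le_hausdorff_dist(2)[OF AB that] h infdist_nonneg[of b A] AB
      by (simp add: in_closed_iff_infdist_zero sym_bodiesD)
    ultimately show "A = B" by blast
  next
    assume "A = B"
    then show "body_dist A B = 0"
      using AB by (simp add: body_dist_def hausdorff_dist_infdist sym_bodiesD cong: SUP_cong_simp)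
  qed
  show "body_dist A C \<le> body_dist A B + body_dist B C"
    if A: "A \<in> sym_bodies" and B: "B \<in> sym_bodies" and C: "C \<in> sym_bodies"
    for A B C :: "(real ^ 'n) set"
  proof -
    have "hausdorff_dist A C \<le> hausdorff_dist A B + hausdorff_dist B C"
    proof (rule hausdorff_dist_leI[OF A C])
      show "infdist a C \<le> hausdorff_dist A B + hausdorff_dist B C" if "a \<in> A" for a
        using infdist_triangle_hausdorff[OF B C infdist_le_hausdorff_dist(1)[OF B C]
            infdist_le_hausdorff_dist(1)[OF A B that]] .
      show "infdist c A \<le> hausdorff_dist A B + hausdorff_dist B C" if "c \<in> C" for c
        using infdist_triangle_hausdorff[OF B A infdist_le_hausdorff_dist(2)[OF A B]
            infdist_le_hausdorff_dist(2)[OF B C that]] by simp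
    qed
    then show ?thesis using A B C by (simp add: body_dist_def)
  qed
qed

end

theory Submission
  imports Defs "HOL-Computational_Algebra.Polynomial"
begin

text \<open>
  Let $d$ be the dimension. For a typical norm, a rational subspace of rank $r$ contains at most
  $dr$ unit vectors up to sign: $r$ vectors have $dr$ real coordinates, and each rational combination
  of them that is required to have norm $1$ is one equation. This property alone yields the bound.

  Meagreness. A failure of the property is witnessed by a rational coefficient matrix with
  more than $dr$ rows, and by a lower bound on how far the unit vectors are from being parallel;
  so there are countably many kinds of failure (\<open>over_dependent\<close>). Each kind is nowhere dense
  (\<open>nowhere_dense_over_dependent\<close>). Indeed, every norm is close to one whose unit ball is a polytope
  with tiny facets, so that unit vectors that are far enough from being parallel lie on different
  pairs of opposite facets. The facets turn the unit conditions into more than $dr$ linear equations in $dr$ unknowns, and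
  a generic choice of the distances of the facets from the origin makes all of these finitely many
  systems unsolvable, even approximately (\<open>approximation_avoiding_over_dependence\<close>).

  Counting. Give each unit direction, up to sign, its number of edges in the point set $P$ as a
  weight. The rank condition lets a greedy rational basis capture at least the fraction $1/d$ of
  the total weight (\<open>greedy_independent_subset\<close>). For rationally independent directions the edges
  form a subgraph of a grid, which has at most $\frac12 n \log_2 n$ edges on $n$ points
  (\<open>sum_edges_rat_independent_le\<close>).\<close>

section \<open>Edges in rationally independent directions\<close>

text \<open>With $a \le b$ and $\rho = a/b$ this is $\rho \log_2 (1 + 1/\rho) + \log_2 (1 + \rho) \ge 2\rho$. The first
  logarithm is at least $1$; the second is at least $\rho$, because $2^\rho$ lies below its chord
  on $[0,1]$.\<close>

lemma xlogx_superadditive: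
  fixes a b :: real
  assumes "0 < a" "0 < b"
  shows "a * log 2 a + b * log 2 b + 2 * min a b \<le> (a + b) * log 2 (a + b)"
proof -
  have main: "a * log 2 a + b * log 2 b + 2 * a \<le> (a + b) * log 2 (a + b)"
    if "0 < a" "a \<le> b" for a b :: real
  proof -
    have "1 \<le> log 2 ((a + b) / a)"
      using that by (subst le_log_iff) (auto simp: field_simps)
    then have 1: "a \<le> a * (log 2 (a + b) - log 2 a)"
      using that by (simp add: log_divide)
    have "2 powr (a / b) = exp ((1 - a / b) *\<^sub>R 0 + (a / b) *\<^sub>R ln 2)"
      by (simp add: powr_def)
    also have "\<dots> \<le> (1 - a / b) * exp 0 + (a / b) * exp (ln 2)"
      using that by (intro convex_onD[OF exp_convex]) auto
    also have "\<dots> = (a + b) / b"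
      using that by (simp add: field_simps)
    finally have "a / b \<le> log 2 ((a + b) / b)"
      using that by (subst le_log_iff) auto
    then have "a \<le> b * (log 2 (a + b) - log 2 b)"
      using that by (simp add: log_divide field_simps)
    with 1 show ?thesis by (simp add: algebra_simps)
  qed
  show ?thesis
    using main[of a b] main[of b a] assms by (cases "a \<le> b") (auto simp: add.commute min_def)
qed

interpretation rat_vs: vector_space "\<lambda>(c::rat) (x::'a::real_vector). of_rat c *\<^sub>R x"
  by standard (auto simp: algebra_simps of_rat_add of_rat_mult)

text \<open>Joining $p$ to $p + u$ for $u \in B$ makes $P$ a subgraph of a grid, since the directions are
  independent over the rationals; this is the edge-isoperimetric inequality in that grid. Cut $P$
  by a threshold on the $u$-coordinate for a direction $u$ that occurs. Only edges in direction
  $u$ cross the cut, and they form a matching, so there are at most as many of them as there are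
  points on the smaller side; the superadditivity of $x \log_2 x$ with the extra
  term $2\min(a,b)$ is what the induction needs.\<close>

lemma sum_edges_rat_independent_le:
  fixes B P :: "'a::real_vector set"
  assumes "finite B" "rat_vs.independent B" "finite P" "P \<noteq> {}"
  shows "real (\<Sum>u\<in>B. card {p \<in> P. p + u \<in> P}) \<le> real (card P) / 2 * log 2 (real (card P))"
  using assms(3,4)
proof (induction "card P" arbitrary: P rule: less_induct)
  case less
  define E where "E P = (\<lambda>u. {p \<in> P. p + u \<in> P})" for P :: "'a set"
  have finE: "finite (E P' u)" if "finite P'" for P' u
    using that by (auto simp: E_def)
  show ?case
  proof (cases "\<exists>u\<in>B. E P u \<noteq> {}")
    case False
    have "1 \<le> card P"
      using less.prems by (simp add: Suc_leI card_gt_0_iff)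
    then have "0 \<le> real (card P) / 2 * log 2 (real (card P))"
      by (intro mult_nonneg_nonneg) auto
    moreover have "(\<Sum>u\<in>B. card (E P u)) = 0"
      using False by simp
    ultimately show ?thesis by (simp add: E_def)
  next
    case True
    then obtain u p0 where u: "u \<in> B" and p0: "p0 \<in> P" "p0 + u \<in> P"
      by (auto simp: E_def)
    \<comment> \<open>the rational-linear coordinate along \<open>u\<close> in a basis that contains \<open>B\<close>\<close>
    define f where "f v = rat_vs.representation (rat_vs.extend_basis B) v u" for v
    have ind: "rat_vs.independent (rat_vs.extend_basis B)"
      and sp: "\<And>v. v \<in> rat_vs.span (rat_vs.extend_basis B)"
      and sub: "B \<subseteq> rat_vs.extend_basis B"
      using rat_vs.independent_extend_basis[OF assms(2)] rat_vs.span_extend_basis[OF assms(2)]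
        rat_vs.extend_basis_superset[OF assms(2)] by auto
    have f_add: "f (v + v') = f v + f v'" for v v'
      unfolding f_def using rat_vs.representation_add[OF ind sp sp] by simp
    have f_B: "f v = (if v = u then 1 else 0)" if "v \<in> B" for v
      unfolding f_def using rat_vs.representation_basis[OF ind] sub that by auto
    define P1 where "P1 = {p \<in> P. f p \<le> f p0}"
    define P2 where "P2 = {p \<in> P. \<not> f p \<le> f p0}"
    have P: "P = P1 \<union> P2" "P1 \<inter> P2 = {}"
      by (auto simp: P1_def P2_def)
    have fin: "finite P1" "finite P2"
      using less.prems by (auto simp: P1_def P2_def)
    have ne: "P1 \<noteq> {}" "P2 \<noteq> {}"
      using p0 f_add f_B[OF u] by (auto simp: P1_def P2_def)
    have card: "card P = card P1 + card P2"
      using P fin by (simp add: card_Un_disjoint)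
    have pos: "0 < card P1" "0 < card P2"
      using fin ne by (auto simp: card_gt_0_iff)
    define C where "C = {p \<in> P1. p + u \<in> P2}"
    have E_other: "E P v \<subseteq> E P1 v \<union> E P2 v" if "v \<in> B" "v \<noteq> u" for v
      using that f_B[OF that(1)] by (auto simp: E_def P1_def P2_def f_add)
    have E_u: "E P u \<subseteq> E P1 u \<union> E P2 u \<union> C"
      using f_B[OF u] by (auto simp: E_def C_def P1_def P2_def f_add)
    have "card C \<le> card P1"
      using fin by (intro card_mono) (auto simp: C_def)
    moreover have "card C \<le> card P2"
      using fin by (intro card_inj_on_le[of "\<lambda>p. p + u"]) (auto simp: C_def)
    ultimately have C: "card C \<le> min (card P1) (card P2)" by simp
    have le: "card (E P v) \<le> card (E P1 v) + card (E P2 v) + (if v = u then card C else 0)"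
      if v: "v \<in> B" for v
    proof (cases "v = u")
      case True
      have "card (E P u) \<le> card (E P1 u \<union> E P2 u \<union> C)"
        using E_u finE fin by (intro card_mono) (auto simp: C_def)
      also have "\<dots> \<le> card (E P1 u) + card (E P2 u) + card C"
        by (meson add_le_mono1 card_Un_le order_trans)
      finally show ?thesis using True by simp
    next
      case False
      have "card (E P v) \<le> card (E P1 v \<union> E P2 v)"
        using E_other[OF v False] finE fin by (intro card_mono) auto
      also have "\<dots> \<le> card (E P1 v) + card (E P2 v)"
        by (rule card_Un_le)
      finally show ?thesis using False by simp
    qed
    have "(\<Sum>v\<in>B. card (E P v)) \<le>
        (\<Sum>v\<in>B. card (E P1 v) + card (E P2 v) + (if v = u then card C else 0))"
      by (intro sum_mono le)
    also have "\<dots> = (\<Sum>v\<in>B. card (E P1 v)) + (\<Sum>v\<in>B. card (E P2 v)) + card C"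
      using u assms(1) by (simp add: sum.distrib)
    finally have "real (\<Sum>v\<in>B. card (E P v)) \<le>
        real (\<Sum>v\<in>B. card (E P1 v)) + real (\<Sum>v\<in>B. card (E P2 v)) + real (card C)"
      by linarith
    moreover have "real (\<Sum>v\<in>B. card (E P1 v)) \<le> real (card P1) / 2 * log 2 (real (card P1))"
      unfolding E_def using less.hyps[of P1] card pos fin ne by simp
    moreover have "real (\<Sum>v\<in>B. card (E P2 v)) \<le> real (card P2) / 2 * log 2 (real (card P2))"
      unfolding E_def using less.hyps[of P2] card pos fin ne by simp
    moreover have "real (card P1) * log 2 (real (card P1)) + real (card P2) * log 2 (real (card P2))
        + 2 * real (card C) \<le> real (card P) * log 2 (real (card P))"
      using xlogx_superadditive[of "real (card P1)" "real (card P2)"] pos C card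
      by (simp add: min_def split: if_splits)
    ultimately show ?thesis unfolding E_def by simp
  qed
qed

section \<open>Greedy bases\<close>

text \<open>If no subset of $A$ has more than $d$ times as many elements as its rank, then $A$ would split
  into $d$ independent sets by Edmonds' matroid partition theorem. Only a weighted consequence is
  needed, and the greedy algorithm gives it directly: process the elements by decreasing weight
  and keep those outside the span of the earlier ones. Among the elements processed so far, $d$
  times the number of kept ones is never less than the number of all, and weights only decrease
  afterwards.\<close>

lemma (in vector_space) greedy_independent_subset:
  fixes e :: "'b \<Rightarrow> nat" and d :: nat
  assumes "finite A"
    and "\<And>A' B. A' \<subseteq> A \<Longrightarrow> B \<subseteq> A' \<Longrightarrow> independent B \<Longrightarrow> A' \<subseteq> span B \<Longrightarrow> card A' \<le> d * card B"
  shows "\<exists>B\<subseteq>A. independent B \<and> sum e A \<le> d * sum e B"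
proof -
  \<comment> \<open>the surplus \<open>d * card B - card A\<close> is charged at a weight \<open>m\<close> that no element undercuts, which
    makes the claim inductive when a lighter element is added; \<open>m = 0\<close> gives the lemma\<close>
  have "\<exists>B\<subseteq>A. independent B \<and> A \<subseteq> span B \<and> (\<forall>m. (\<forall>u\<in>A. m \<le> e u) \<longrightarrow>
      int (sum e A) + (int d * int (card B) - int (card A)) * int m \<le> int d * int (sum e B))"
    using assms
  proof (induction A rule: finite_ranking_induct[where f = "\<lambda>u. - int (e u)"])
    case empty
    show ?case by (auto simp: independent_empty)
  next
    case (insert x A)
    show ?case
    proof (cases "x \<in> A")
      case True
      then show ?thesis using insert by (simp add: insert_absorb)
    next
      case False
      have hyp: "card A' \<le> d * card B"
        if "A' \<subseteq> A" "B \<subseteq> A'" "independent B" "A' \<subseteq> span B" for A' B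
        using insert.prems[of A' B] that by blast
      obtain B where B: "B \<subseteq> A" "independent B" "A \<subseteq> span B"
        and le: "\<And>m. \<forall>u\<in>A. m \<le> e u \<Longrightarrow>
          int (sum e A) + (int d * int (card B) - int (card A)) * int m \<le> int d * int (sum e B)"
        using insert.IH[OF hyp] by blast
      have le_x: "int (sum e A) + (int d * int (card B) - int (card A)) * int (e x)
          \<le> int d * int (sum e B)"
        using insert.hyps by (intro le) auto
      have finB: "finite B" and xB: "x \<notin> B"
        using B insert.hyps False by (auto intro: finite_subset)
      define B' where "B' = (if x \<in> span B then B else insert x B)"
      have B': "B' \<subseteq> insert x A" "independent B'" "insert x A \<subseteq> span B'"
        using B span_mono[of B "insert x B"] span_base[of x "insert x B"]
        by (auto simp: B'_def independent_insert)
      have "card (insert x A) \<le> d * card B'"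
        using insert.prems[OF order_refl] B' by blast
      then have surplus: "0 \<le> int d * int (card B') - int (card (insert x A))"
        by (metis diff_ge_0_iff_ge of_nat_le_iff of_nat_mult)
      have "int (sum e (insert x A)) + (int d * int (card B') - int (card (insert x A))) * int m
          \<le> int d * int (sum e B')" if m: "m \<le> e x" for m
      proof -
        have "(int d * int (card B') - int (card (insert x A))) * int m
            \<le> (int d * int (card B') - int (card (insert x A))) * int (e x)"
          using m by (intro mult_left_mono[OF _ surplus]) simp
        then show ?thesis
          using le_x finB xB insert.hyps False
          by (auto simp: B'_def algebra_simps split: if_splits)
      qed
      with B' show ?thesis by blast
    qed
  qed
  then obtain B where "B \<subseteq> A" "independent B" and
    le: "\<And>m. \<forall>u\<in>A. m \<le> e u \<Longrightarrow>
      int (sum e A) + (int d * int (card B) - int (card A)) * int m \<le> int d * int (sum e B)"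
    by blast
  moreover have "int (sum e A) \<le> int d * int (sum e B)"
    using le[of 0] by simp
  ultimately show ?thesis
    by (metis of_nat_le_iff of_nat_mult)
qed

section \<open>Norms and supporting functionals\<close>

lemma is_normD:
  assumes "is_norm N"
  shows "0 \<le> N x" "N x = 0 \<longleftrightarrow> x = 0" "N (c *\<^sub>R x) = \<bar>c\<bar> * N x" "N (x + y) \<le> N x + N y"
  using assms unfolding is_norm_def by blast+

lemma is_norm_minus:
  assumes "is_norm N"
  shows "N (- x) = N x"
  using is_normD(3)[OF assms, of "-1" x] by simp

lemma is_norm_zero:
  assumes "is_norm N"
  shows "N 0 = 0"
  using is_normD(2)[OF assms, of 0] by simp

lemma is_norm_sum_le:
  assumes "is_norm N"
  shows "N (\<Sum>i\<in>I. f i) \<le> (\<Sum>i\<in>I. N (f i))"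
proof (induction I rule: infinite_finite_induct)
  case (insert i I)
  have "N (sum f (insert i I)) = N (f i + sum f I)"
    by (simp only: sum.insert[OF insert.hyps])
  also have "\<dots> \<le> N (f i) + N (sum f I)"
    by (rule is_normD(4)[OF assms])
  finally show ?case
    using insert.IH by (simp only: sum.insert[OF insert.hyps])
qed (simp_all add: is_norm_zero[OF assms])

lemma is_norm_diff_le:
  assumes "is_norm N"
  shows "\<bar>N x - N y\<bar> \<le> N (x - y)"
proof -
  have "N x \<le> N (x - y) + N y" "N y \<le> N (y - x) + N x"
    using is_normD(4)[OF assms, of "x - y" y] is_normD(4)[OF assms, of "y - x" x] by simp_all
  moreover have "N (y - x) = N (x - y)"
    using is_norm_minus[OF assms, of "x - y"] unfolding minus_diff_eq .
  ultimately show ?thesis by linarith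
qed

lemma is_norm_upper_bound:
  fixes N :: "real ^ 'n \<Rightarrow> real"
  assumes "is_norm N"
  obtains \<beta> where "0 < \<beta>" "\<And>x. N x \<le> \<beta> * norm x"
proof -
  define \<beta> where "\<beta> = (\<Sum>i\<in>UNIV. N (axis i 1)) + 1"
  have "0 \<le> (\<Sum>i\<in>UNIV. N (axis i 1))"
    by (intro sum_nonneg is_normD(1)[OF assms])
  moreover have "N x \<le> \<beta> * norm x" for x
  proof -
    have "N x = N (\<Sum>i\<in>UNIV. (x $ i) *\<^sub>R axis i 1)"
      by (rule arg_cong[of _ _ N]) (rule basis_expansion[of x, symmetric, unfolded scalar_mult_eq_scaleR])
    also have "\<dots> \<le> (\<Sum>i\<in>UNIV. \<bar>x $ i\<bar> * N (axis i 1))"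
      using is_norm_sum_le[OF assms, of "\<lambda>i. (x $ i) *\<^sub>R axis i 1" UNIV]
      by (simp add: is_normD(3)[OF assms])
    also have "\<dots> \<le> (\<Sum>i\<in>UNIV. norm x * N (axis i 1))"
      by (intro sum_mono mult_right_mono component_le_norm_cart is_normD(1)[OF assms])
    also have "\<dots> \<le> \<beta> * norm x"
      by (simp add: \<beta>_def algebra_simps flip: sum_distrib_left)
    finally show ?thesis .
  qed
  ultimately show ?thesis
    using that[of \<beta>] by (simp add: \<beta>_def)
qed

lemma is_norm_continuous_on:
  fixes N :: "real ^ 'n \<Rightarrow> real"
  assumes "is_norm N"
  shows "continuous_on S N"
proof -
  obtain \<beta> where \<beta>: "0 < \<beta>" "\<And>x. N x \<le> \<beta> * norm x"
    using is_norm_upper_bound[OF assms] by blast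
  have "\<bar>N x - N y\<bar> \<le> \<beta> * norm (x - y)" for x y
    using is_norm_diff_le[OF assms, of x y] \<beta>(2)[of "x - y"] by linarith
  then have "\<beta>-lipschitz_on S N"
    using \<beta>(1) by (intro lipschitz_onI) (auto simp: dist_norm)
  then show ?thesis by (rule lipschitz_on_continuous_on)
qed

lemma is_norm_lower_bound:
  fixes N :: "real ^ 'n \<Rightarrow> real"
  assumes "is_norm N"
  obtains \<alpha> where "0 < \<alpha>" "\<And>x. \<alpha> * norm x \<le> N x"
proof -
  have "compact (sphere (0 :: real ^ 'n) 1)" by simp
  moreover have "sphere (0 :: real ^ 'n) 1 \<noteq> {}" by simp
  ultimately obtain p where p: "p \<in> sphere 0 1" and le: "\<And>x. x \<in> sphere 0 1 \<Longrightarrow> N p \<le> N x"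
    using continuous_attains_inf is_norm_continuous_on[OF assms] by meson
  have "0 < N p"
    using p is_normD(1,2)[OF assms, of p] by (auto simp: less_le)
  moreover have "N p * norm x \<le> N x" for x
  proof (cases "x = 0")
    case False
    then show ?thesis
      using le[of "x /\<^sub>R norm x"] by (simp add: is_normD(3)[OF assms] field_simps)
  qed (use is_normD(1)[OF assms, of 0] in simp)
  ultimately show ?thesis by (rule that)
qed

lemma unit_ball_in_sym_bodies:
  fixes N :: "real ^ 'n \<Rightarrow> real"
  assumes "is_norm N"
  shows "unit_ball N \<in> sym_bodies"
proof -
  obtain \<alpha> where \<alpha>: "0 < \<alpha>" "\<And>x. \<alpha> * norm x \<le> N x"
    using is_norm_lower_bound[OF assms] by blast
  obtain \<beta> where \<beta>: "0 < \<beta>" "\<And>x. N x \<le> \<beta> * norm x"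
    using is_norm_upper_bound[OF assms] by blast
  have "closed {x. N x \<le> 1}"
    by (intro closed_Collect_le is_norm_continuous_on[OF assms] continuous_on_const)
  moreover have "bounded {x. N x \<le> 1}"
  proof (rule boundedI)
    fix x assume "x \<in> {x. N x \<le> 1}"
    then show "norm x \<le> 1 / \<alpha>"
      using \<alpha>(1) \<alpha>(2)[of x] by (simp add: field_simps)
  qed
  moreover have "convex {x. N x \<le> 1}"
  proof (rule convexI, clarsimp)
    fix x y and u v :: real
    assume "N x \<le> 1" "N y \<le> 1" "0 \<le> u" "0 \<le> v" "u + v = 1"
    then show "N (u *\<^sub>R x + v *\<^sub>R y) \<le> 1"
      using is_normD(4)[OF assms, of "u *\<^sub>R x" "v *\<^sub>R y"]
        mult_left_mono[of "N x" 1 u] mult_left_mono[of "N y" 1 v]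
      by (simp add: is_normD(3)[OF assms])
  qed
  moreover have "0 \<in> interior {x. N x \<le> 1}"
  proof (rule interiorI)
    show "ball 0 (1 / \<beta>) \<subseteq> {x. N x \<le> 1}"
      using \<beta> by (auto simp: field_simps intro: order_trans[OF \<beta>(2)])
  qed (use \<beta> in auto)
  ultimately show ?thesis
    by (auto simp: sym_bodies_def unit_ball_def is_norm_minus[OF assms])
qed

text \<open>A hyperplane separating the open unit ball from $p / N(p)$ supports the ball at that point; the
  functional is rescaled so that its value on the ball is at most $1$.\<close>

lemma norm_supporting_functional:
  fixes N :: "real ^ 'n \<Rightarrow> real"
  assumes "is_norm N"
  obtains u where "u \<bullet> p = N p" "\<And>x. \<bar>u \<bullet> x\<bar> \<le> N x"
proof (cases "p = 0")
  case True
  then show ?thesis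
    using that[of 0] is_normD(1)[OF assms] is_norm_zero[OF assms] by simp
next
  case False
  then have Np: "0 < N p"
    using is_normD(1,2)[OF assms, of p] by (auto simp: less_le)
  let ?S = "{x. N x < 1}"
  have "convex ?S"
  proof (rule convexI, clarsimp)
    fix x y and u v :: real
    assume *: "N x < 1" "N y < 1" "0 \<le> u" "0 \<le> v" "u + v = 1"
    then have "u * N x + v * N y < 1"
      by (intro convex_bound_lt) auto
    then show "N (u *\<^sub>R x + v *\<^sub>R y) < 1"
      using is_normD(4)[OF assms, of "u *\<^sub>R x" "v *\<^sub>R y"] *
      by (simp add: is_normD(3)[OF assms])
  qed
  moreover have N0: "0 \<in> ?S"
    by (simp add: is_norm_zero[OF assms])
  moreover have "?S \<inter> {p /\<^sub>R N p} = {}"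
    using Np by (simp add: is_normD(3)[OF assms])
  ultimately obtain a b where "a \<noteq> 0" and below: "\<And>x. N x < 1 \<Longrightarrow> a \<bullet> x \<le> b"
    and above: "b \<le> a \<bullet> (p /\<^sub>R N p)"
    using separating_hyperplane_sets[of ?S "{p /\<^sub>R N p}"] by auto
  have scaled: "a \<bullet> x \<le> b * N x" for x
  proof (cases "x = 0")
    case False
    then have "0 < N x"
      using is_normD(1,2)[OF assms, of x] by (auto simp: less_le)
    then have "\<theta> * (a \<bullet> x / N x) \<le> b" if "0 < \<theta>" "\<theta> < 1" for \<theta>
      using below[of "(\<theta> / N x) *\<^sub>R x"] that by (simp add: is_normD(3)[OF assms])
    then have "a \<bullet> x / N x \<le> b"
      by (rule field_le_mult_one_interval)
    then show ?thesis
      using \<open>0 < N x\<close> by (simp add: field_simps)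
  qed (simp add: is_norm_zero[OF assms])
  have "0 < a \<bullet> a" using \<open>a \<noteq> 0\<close> by simp
  then have "0 < b * N a" using scaled[of a] by linarith
  then have b: "0 < b" using is_normD(1)[OF assms, of a] by (simp add: zero_less_mult_iff)
  have eq: "a \<bullet> p = b * N p"
    using above scaled[of p] Np by (simp add: field_simps)
  show ?thesis
  proof (rule that[of "a /\<^sub>R b"])
    show "(a /\<^sub>R b) \<bullet> p = N p" using eq b by simp
    show "\<bar>(a /\<^sub>R b) \<bullet> x\<bar> \<le> N x" for x
      using scaled[of x] scaled[of "- x"] b
      by (simp add: is_norm_minus[OF assms] abs_le_iff field_simps)
  qed
qed

section \<open>Hausdorff distance of unit balls\<close>

lemma hausdorff_dist_unit_ball_le:
  fixes N N' :: "real ^ 'n \<Rightarrow> real"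
  assumes N: "is_norm N" and N': "is_norm N'"
    and \<alpha>: "0 < \<alpha>" "\<And>x. \<alpha> * norm x \<le> N x"
    and \<zeta>: "0 \<le> \<zeta>" "\<zeta> \<le> 1 / 2" "\<And>x. \<bar>N' x - N x\<bar> \<le> \<zeta> * N x"
  shows "hausdorff_dist (unit_ball N) (unit_ball N') \<le> 2 * \<zeta> / \<alpha>"
proof (rule hausdorff_dist_leI[OF unit_ball_in_sym_bodies[OF N] unit_ball_in_sym_bodies[OF N']])
  have shrink: "infdist x K \<le> 2 * \<zeta> / \<alpha>"
    if "(1 - \<zeta>) *\<^sub>R x \<in> K" "N x \<le> 2" for x K
  proof -
    have "norm x \<le> 2 / \<alpha>"
      using \<alpha>(1) \<alpha>(2)[of x] that(2) by (simp add: field_simps)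
    then have "\<zeta> * norm x \<le> 2 * \<zeta> / \<alpha>"
      using mult_left_mono[of "norm x" "2 / \<alpha>" \<zeta>] \<zeta>(1) by (simp add: mult.commute)
    moreover have "x - (1 - \<zeta>) *\<^sub>R x = \<zeta> *\<^sub>R x"
      by (simp add: scaleR_left_diff_distrib)
    then have "dist x ((1 - \<zeta>) *\<^sub>R x) = \<zeta> * norm x"
      using \<zeta>(1) by (simp add: dist_norm)
    ultimately show ?thesis
      using infdist_le[OF that(1), of x] by linarith
  qed
  show "infdist x (unit_ball N') \<le> 2 * \<zeta> / \<alpha>" if "x \<in> unit_ball N" for x
  proof (rule shrink)
    have Nx: "0 \<le> N x" "N x \<le> 1"
      using that is_normD(1)[OF N] by (auto simp: unit_ball_def)
    then show "N x \<le> 2" by simp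
    have "(1 - \<zeta>) * N' x \<le> (1 - \<zeta>) * ((1 + \<zeta>) * N x)"
      using \<zeta>(2) \<zeta>(3)[of x] by (intro mult_left_mono) (auto simp: algebra_simps)
    also have "\<dots> = (1 - \<zeta>\<^sup>2) * N x" by (simp add: power2_eq_square algebra_simps)
    also have "\<dots> \<le> 1"
      using Nx by (intro mult_le_one) (auto)
    finally show "(1 - \<zeta>) *\<^sub>R x \<in> unit_ball N'"
      using \<zeta>(2) by (simp add: unit_ball_def is_normD(3)[OF N'])
  qed
  show "infdist x (unit_ball N) \<le> 2 * \<zeta> / \<alpha>" if "x \<in> unit_ball N'" for x
  proof (rule shrink)
    have N'x: "0 \<le> N x" "N' x \<le> 1"
      using that is_normD(1)[OF N] by (auto simp: unit_ball_def)
    have le: "(1 - \<zeta>) * N x \<le> 1"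
      using \<zeta>(3)[of x] N'x by (simp add: algebra_simps)
    then show "(1 - \<zeta>) *\<^sub>R x \<in> unit_ball N"
      using \<zeta>(2) by (simp add: unit_ball_def is_normD(3)[OF N])
    have "1 / 2 * N x \<le> (1 - \<zeta>) * N x"
      using \<zeta>(2) N'x by (intro mult_right_mono) auto
    then show "N x \<le> 2" using le by simp
  qed
qed

text \<open>The upper bound on $N$ moves a point of the ball of $M$ to a nearby point of the ball of $N$. For
  the lower bound, let $u$ support the ball of $M$ in direction $x$ and let $k$ maximise $u$ on the
  ball of $N$. Since that ball contains the Euclidean ball of radius $1/\beta$, passing from $k$ to a
  nearby point of the ball of $M$ costs at most the fraction $\eta$ of $u \cdot k$. This is
  cancellation of $\eta K$ in $K \subseteq L + \eta K$ for the unit balls $K$ of $N$ and $L$ of $M$,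
  expressed by support functions.\<close>

lemma norm_close_of_hausdorff_dist:
  fixes N M :: "real ^ 'n \<Rightarrow> real"
  assumes N: "is_norm N" and M: "is_norm M"
    and \<beta>: "0 < \<beta>" "\<And>x. N x \<le> \<beta> * norm x"
    and \<eta>: "0 \<le> \<eta>" "\<eta> < 1"
    and h: "hausdorff_dist (unit_ball N) (unit_ball M) \<le> \<eta> / \<beta>"
  shows "\<bar>N x - M x\<bar> \<le> \<eta> * M x"
proof -
  note bodies = unit_ball_in_sym_bodies[OF N] unit_ball_in_sym_bodies[OF M]
  have near: "\<exists>z\<in>K. norm (y - z) \<le> \<eta> / \<beta>" if K: "K \<in> sym_bodies" and y: "infdist y K \<le> \<eta> / \<beta>"
    for y and K :: "(real ^ 'n) set"
  proof -
    obtain z where "z \<in> K" "infdist y K = dist y z"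
      using infdist_attains_inf sym_bodiesD(2,3)[OF K] by metis
    then show ?thesis using y by (auto simp: dist_norm)
  qed
  have upper: "N x \<le> (1 + \<eta>) * M x"
  proof (cases "x = 0")
    case False
    then have Mx: "0 < M x" using is_normD(1,2)[OF M, of x] by (auto simp: less_le)
    define y where "y = x /\<^sub>R M x"
    have "M y \<le> 1" using Mx by (simp add: y_def is_normD(3)[OF M])
    then have "infdist y (unit_ball N) \<le> \<eta> / \<beta>"
      using infdist_le_hausdorff_dist(2)[OF bodies, of y] h by (simp add: unit_ball_def)
    then obtain z where z: "N z \<le> 1" "norm (y - z) \<le> \<eta> / \<beta>"
      using near[OF bodies(1)] by (auto simp: unit_ball_def)
    have "N y \<le> N z + N (y - z)"
      using is_normD(4)[OF N, of z "y - z"] by simp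
    also have "\<dots> \<le> 1 + \<beta> * (\<eta> / \<beta>)"
      using z \<beta>(1) by (intro add_mono order_trans[OF \<beta>(2)[of "y - z"]] mult_left_mono) auto
    finally show ?thesis
      using Mx \<beta>(1) by (simp add: y_def is_normD(3)[OF N] pos_divide_le_eq divide_inverse_commute[symmetric])
  qed (simp add: is_norm_zero[OF N] is_norm_zero[OF M])
  have lower: "(1 - \<eta>) * M x \<le> N x"
  proof (cases "x = 0")
    case False
    then have Nx: "0 < N x" using is_normD(1,2)[OF N, of x] by (auto simp: less_le)
    obtain u where u: "u \<bullet> x = M x" "\<And>y. \<bar>u \<bullet> y\<bar> \<le> M y"
      using norm_supporting_functional[OF M] by blast
    obtain k where k: "k \<in> unit_ball N" "\<And>y. y \<in> unit_ball N \<Longrightarrow> u \<bullet> y \<le> u \<bullet> k"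
      using continuous_attains_sup[OF sym_bodiesD(1,2)[OF bodies(1)], of "\<lambda>y. u \<bullet> y"]
        continuous_on_inner[OF continuous_on_const continuous_on_id] by blast
    have "infdist k (unit_ball M) \<le> \<eta> / \<beta>"
      using infdist_le_hausdorff_dist(1)[OF bodies k(1)] h by simp
    then obtain z where z: "M z \<le> 1" "norm (k - z) \<le> \<eta> / \<beta>"
      using near[OF bodies(2)] by (auto simp: unit_ball_def)
    have "norm u \<le> \<beta> * (u \<bullet> k)"
    proof (cases "u = 0")
      case False
      have "N (u /\<^sub>R (\<beta> * norm u)) \<le> 1"
        using \<beta>(1) \<beta>(2)[of u] False
        by (simp add: is_normD(3)[OF N] pos_divide_le_eq divide_inverse_commute[symmetric] abs_mult
            del: inverse_mult_distrib)
      then have "u \<bullet> (u /\<^sub>R (\<beta> * norm u)) \<le> u \<bullet> k"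
        by (intro k(2)) (simp add: unit_ball_def)
      moreover have "u \<bullet> (u /\<^sub>R (\<beta> * norm u)) = norm u / \<beta>"
      proof -
        have "u \<bullet> (u /\<^sub>R c) = (norm u)\<^sup>2 / c" for c
          by (simp add: dot_square_norm divide_inverse_commute)
        also have "(norm u)\<^sup>2 / (\<beta> * norm u) = norm u / \<beta>"
          using False by (simp add: power2_eq_square)
        finally show ?thesis .
      qed
      ultimately have "norm u / \<beta> \<le> u \<bullet> k"
        by (simp only:)
      then show ?thesis
        using \<beta>(1) by (simp add: pos_divide_le_eq mult.commute)
    qed simp
    then have "norm u * (\<eta> / \<beta>) \<le> \<beta> * (u \<bullet> k) * (\<eta> / \<beta>)"
      using \<eta>(1) \<beta>(1) by (intro mult_right_mono) auto
    then have "norm u * (\<eta> / \<beta>) \<le> \<eta> * (u \<bullet> k)"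
      using \<beta>(1) by (simp add: mult.commute)
    moreover have "u \<bullet> (k - z) \<le> norm u * (\<eta> / \<beta>)"
      using z(2) by (intro order_trans[OF norm_cauchy_schwarz] mult_left_mono) auto
    moreover have "u \<bullet> z \<le> 1" using u(2)[of z] z(1) by linarith
    ultimately have "u \<bullet> k - \<eta> * (u \<bullet> k) \<le> 1"
      unfolding inner_diff_right by linarith
    then have uk: "(1 - \<eta>) * (u \<bullet> k) \<le> 1"
      by (simp only: left_diff_distrib mult_1)
    have "u \<bullet> (x /\<^sub>R N x) \<le> u \<bullet> k"
      using Nx by (intro k(2)) (simp add: unit_ball_def is_normD(3)[OF N])
    moreover have "u \<bullet> (x /\<^sub>R N x) = M x / N x"
      using u(1) by (simp add: divide_inverse_commute)
    ultimately have "M x / N x \<le> u \<bullet> k"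
      by (simp only:)
    then have "(1 - \<eta>) * (M x / N x) \<le> (1 - \<eta>) * (u \<bullet> k)"
      using \<eta>(2) by (intro mult_left_mono) simp_all
    then have "(1 - \<eta>) * (M x / N x) \<le> 1"
      using uk by (rule order_trans)
    then show ?thesis using Nx by (simp add: pos_divide_le_eq)
  qed (simp add: is_norm_zero[OF N] is_norm_zero[OF M])
  show ?thesis using upper lower by (simp add: abs_le_iff algebra_simps)
qed

section \<open>Linear dependence and generic weights\<close>

lemma underdetermined_homogeneous_system:
  fixes M :: "'e \<Rightarrow> 'i \<Rightarrow> 'a::field"
  assumes "finite E" "finite I" "card E < card I"
  shows "\<exists>\<nu>. (\<exists>i\<in>I. \<nu> i \<noteq> 0) \<and> (\<forall>e\<in>E. (\<Sum>i\<in>I. \<nu> i * M e i) = 0)"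
  using assms
proof (induction E arbitrary: I M rule: finite_induct)
  case empty
  then have "I \<noteq> {}" by auto
  then show ?case by (intro exI[of _ "\<lambda>_. 1"]) auto
next
  case (insert e E)
  show ?case
  proof (cases "\<forall>i\<in>I. M e i = 0")
    case True
    then show ?thesis
      using insert.IH[of I M] insert.prems insert.hyps by (auto intro!: sum.neutral)
  next
    case False
    then obtain i0 where i0: "i0 \<in> I" "M e i0 \<noteq> 0" by blast
    define I' where "I' = I - {i0}"
    define M' where "M' e' i = M e' i - M e i * M e' i0 / M e i0" for e' i
    have I': "finite I'" "card E < card I'"
      using insert.prems insert.hyps i0 by (auto simp: I'_def)
    obtain \<nu> where nz: "\<exists>i\<in>I'. \<nu> i \<noteq> 0" and sol: "\<And>e'. e' \<in> E \<Longrightarrow> (\<Sum>i\<in>I'. \<nu> i * M' e' i) = 0"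
      using insert.IH[OF I', of M'] by blast
    define \<mu> where "\<mu> = \<nu>(i0 := - (\<Sum>i\<in>I'. \<nu> i * M e i) / M e i0)"
    have split: "(\<Sum>i\<in>I. \<mu> i * M e' i) =
        - (\<Sum>i\<in>I'. \<nu> i * M e i) / M e i0 * M e' i0 + (\<Sum>i\<in>I'. \<nu> i * M e' i)" for e'
    proof -
      have "(\<Sum>i\<in>I'. \<mu> i * M e' i) = (\<Sum>i\<in>I'. \<nu> i * M e' i)"
        by (intro sum.cong) (auto simp: \<mu>_def I'_def)
      then show ?thesis
        using sum.remove[OF insert.prems(1) i0(1), of "\<lambda>i. \<mu> i * M e' i"]
        by (simp add: I'_def \<mu>_def)
    qed
    have "(\<Sum>i\<in>I. \<mu> i * M e' i) = 0" if "e' \<in> insert e E" for e'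
    proof (cases "e' = e")
      case True
      then show ?thesis using i0 by (simp add: split)
    next
      case False
      then have "(\<Sum>i\<in>I'. \<nu> i * M' e' i) = 0" using that sol by blast
      moreover have "(\<Sum>i\<in>I'. \<nu> i * M' e' i) =
          (\<Sum>i\<in>I'. \<nu> i * M e' i) - (\<Sum>i\<in>I'. \<nu> i * M e i) * M e' i0 / M e i0"
        by (simp add: M'_def algebra_simps sum_subtractf sum_distrib_left sum_divide_distrib)
      ultimately show ?thesis by (simp add: split)
    qed
    moreover have "\<exists>i\<in>I. \<mu> i \<noteq> 0"
      using nz by (auto simp: \<mu>_def I'_def)
    ultimately show ?thesis by blast
  qed
qed

text \<open>For fixed vectors $w_i$, the linear forms
  $(x_j)_j \mapsto w_i \cdot \sum_j c_{ij} x_j$ live in a space of dimension $dr$, so any $k > dr$ of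
  them are linearly dependent.\<close>

lemma vector_weights_annihilating:
  fixes c :: "nat \<Rightarrow> nat \<Rightarrow> real" and w :: "nat \<Rightarrow> real ^ 'n"
  assumes "CARD('n) * r < k"
  shows "\<exists>\<nu>. (\<exists>i<k. \<nu> i \<noteq> 0) \<and> (\<forall>j<r. (\<Sum>i<k. (\<nu> i * c i j) *\<^sub>R w i) = 0)"
proof -
  let ?E = "(UNIV :: 'n set) \<times> {..<r}"
  have "card ?E < card {..<k}" using assms by (simp add: card_cartesian_product)
  then obtain \<nu> where nz: "\<exists>i\<in>{..<k}. \<nu> i \<noteq> 0"
    and sol: "\<And>b j. j < r \<Longrightarrow> (\<Sum>i<k. \<nu> i * (c i j * (w i $ b))) = 0"
    using underdetermined_homogeneous_system[of ?E "{..<k}" "\<lambda>(b, j) i. c i j * (w i $ b)"]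
    by auto
  have "(\<Sum>i<k. (\<nu> i * c i j) *\<^sub>R w i) = 0" if "j < r" for j
    using sol[OF that] by (simp add: vec_eq_iff mult.assoc)
  then show ?thesis using nz by blast
qed

text \<open>Weights $t(v) = 1 - s^{e(v)+1}$ with distinct exponents: each forbidden relation becomes a non-zero
  polynomial equation in $s$, so all but finitely many $s$ in $(0,\tau)$ work.\<close>

lemma generic_weights:
  fixes F :: "'b set" and \<Phi> :: "((nat \<Rightarrow> 'b) \<times> (nat \<Rightarrow> real)) set"
  assumes F: "finite F" and \<Phi>: "finite \<Phi>" and \<tau>: "0 < \<tau>" "\<tau> < 1"
    and inj: "\<And>p \<mu>. (p, \<mu>) \<in> \<Phi> \<Longrightarrow> inj_on p {..<k} \<and> p ` {..<k} \<subseteq> F \<and> (\<exists>i<k. \<mu> i \<noteq> 0)"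
  obtains t where "\<And>v. v \<in> F \<Longrightarrow> 1 - \<tau> \<le> t v \<and> t v \<le> 1"
    and "\<And>p \<mu>. (p, \<mu>) \<in> \<Phi> \<Longrightarrow> (\<Sum>i<k. \<mu> i * t (p i)) \<noteq> 0"
proof -
  obtain e :: "'b \<Rightarrow> nat" where e: "inj_on e F"
    using finite_imp_inj_to_nat_seg[OF F] by blast
  define f where "f = (\<lambda>(p, \<mu>). \<Sum>i<k. smult (\<mu> i) (1 - monom 1 (Suc (e (p i)))) :: real poly)"
  have "f (p, \<mu>) \<noteq> 0" if mem: "(p, \<mu>) \<in> \<Phi>" for p \<mu>
  proof -
    obtain i0 where i0: "i0 < k" "\<mu> i0 \<noteq> 0" using inj[OF mem] by blast
    have "e (p i) = e (p i0) \<longleftrightarrow> i = i0" if "i < k" for i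
      using inj[OF mem] e i0 that by (auto simp: inj_on_def image_subset_iff)
    then have "coeff (f (p, \<mu>)) (Suc (e (p i0))) = (\<Sum>i<k. if i = i0 then - \<mu> i else 0)"
      unfolding f_def coeff_sum prod.case by (intro sum.cong) auto
    also have "\<dots> = - \<mu> i0" using i0 by simp
    finally show ?thesis using i0 by auto
  qed
  then have "finite (\<Union>z\<in>\<Phi>. {s. poly (f z) s = 0})"
    using \<Phi> poly_roots_finite by (intro finite_UN_I) auto
  moreover have "infinite {0<..<\<tau>}" using \<tau> by simp
  ultimately obtain s where s: "s \<in> {0<..<\<tau>}" "s \<notin> (\<Union>z\<in>\<Phi>. {s. poly (f z) s = 0})"
    by (meson finite_subset subsetI)
  show ?thesis
  proof (rule that[of "\<lambda>v. 1 - s ^ Suc (e v)"])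
    show "1 - \<tau> \<le> 1 - s ^ Suc (e v) \<and> 1 - s ^ Suc (e v) \<le> 1" for v
      using s(1) \<tau> power_decreasing[of 1 "Suc (e v)" s] by (auto simp del: power_Suc)
    show "(\<Sum>i<k. \<mu> i * (1 - s ^ Suc (e (p i)))) \<noteq> 0" if "(p, \<mu>) \<in> \<Phi>" for p \<mu>
      using s(2) that by (force simp: f_def poly_sum poly_monom)
  qed
qed

text \<open>The quantity $|a||b| - |a \cdot b|$ vanishes exactly for parallel vectors and ignores signs. It
  is small if both lines are close to the line of $p$, by
  $2|a||b|(|a||b| - a \cdot b) = \bigl||b|a - |a|b\bigr|^2$ and the triangle inequality through
  multiples of $p$.\<close>

lemma nonparallelism_le_of_common_direction:
  fixes a b p :: "'a::real_inner"
  assumes p: "norm p = 1" and a: "norm a - \<bar>p \<bullet> a\<bar> \<le> \<epsilon>" and b: "norm b - \<bar>p \<bullet> b\<bar> \<le> \<epsilon>"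
  shows "norm a * norm b - \<bar>a \<bullet> b\<bar> \<le> 2 * \<epsilon> * (norm a + norm b)"
proof -
  have aligned: "norm a * norm b - a \<bullet> b \<le> 2 * \<epsilon> * (norm a + norm b)"
    if a: "norm a - p \<bullet> a \<le> \<epsilon>" and b: "norm b - p \<bullet> b \<le> \<epsilon>" for a b
  proof (cases "a = 0 \<or> b = 0")
    case True
    have "0 \<le> \<epsilon>"
      using a norm_cauchy_schwarz[of p a] p by simp
    then show ?thesis using True by auto
  next
    case False
    have sq_inner: "x \<bullet> x = norm x * norm x" for x :: 'a
      by (simp add: dot_square_norm power2_eq_square)
    have sq: "(norm (x - norm x *\<^sub>R p))\<^sup>2 = 2 * norm x * (norm x - p \<bullet> x)" for x
      unfolding power2_norm_eq_inner inner_diff_left inner_diff_right inner_scaleR_left inner_scaleR_right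
      by (simp add: inner_commute[of x p] p sq_inner algebra_simps)
    let ?v = "norm b *\<^sub>R (a - norm a *\<^sub>R p)" and ?w = "norm a *\<^sub>R (b - norm b *\<^sub>R p)"
    have "2 * (norm a * norm b) * (norm a * norm b - a \<bullet> b) = (norm (norm b *\<^sub>R a - norm a *\<^sub>R b))\<^sup>2"
      unfolding power2_norm_eq_inner inner_diff_left inner_diff_right inner_scaleR_left inner_scaleR_right
      by (simp add: inner_commute[of b a] sq_inner algebra_simps)
    also have "norm b *\<^sub>R a - norm a *\<^sub>R b = ?v - ?w"
      by (simp add: algebra_simps)
    also have "(norm (?v - ?w))\<^sup>2 \<le> 2 * ((norm ?v)\<^sup>2 + (norm ?w)\<^sup>2)"
      using zero_le_power2[of "norm (?v + ?w)"]
      unfolding power2_norm_eq_inner inner_diff inner_add_left inner_add_right by simp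
    also have "\<dots> = 4 * (norm a * norm b) * (norm b * (norm a - p \<bullet> a) + norm a * (norm b - p \<bullet> b))"
      by (simp add: power_mult_distrib sq) (simp add: power2_eq_square algebra_simps)
    also have "\<dots> \<le> 4 * (norm a * norm b) * (norm b * \<epsilon> + norm a * \<epsilon>)"
      using a b by (intro mult_left_mono add_mono) auto
    finally have "2 * (norm a * norm b) * (norm a * norm b - a \<bullet> b) \<le>
        2 * (norm a * norm b) * (2 * \<epsilon> * (norm a + norm b))"
      by (simp add: algebra_simps)
    then show ?thesis using False by (simp add: mult_le_cancel_left)
  qed
  define \<sigma> where "\<sigma> x = (if p \<bullet> x < 0 then - x else x)" for x
  have "norm (\<sigma> x) = norm x" "p \<bullet> \<sigma> x = \<bar>p \<bullet> x\<bar>" for x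
    by (auto simp: \<sigma>_def)
  moreover have "\<sigma> a \<bullet> \<sigma> b \<le> \<bar>a \<bullet> b\<bar>"
    by (auto simp: \<sigma>_def)
  ultimately show ?thesis using aligned[of "\<sigma> a" "\<sigma> b"] a b by simp
qed

section \<open>Approximation by polytopes with small generic facets\<close>

text \<open>When $Q$ has more than $dr$ rows, a rational subspace of rank $r$ contains too many unit vectors:
  the $a_i$ are the rational combinations of $x_0, \dots, x_{r-1}$ given by the rows of $Q$. The
  coefficients are rational lists, of which there are only countably many. The number $\kappa$ keeps
  the $a_i$ quantitatively non-parallel, without which the condition would not be stable under
  limits of norms.\<close>

definition over_dependent :: "rat list list \<Rightarrow> nat \<Rightarrow> real \<Rightarrow> (real ^ 'n \<Rightarrow> real) \<Rightarrow> bool" where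
  "over_dependent Q r \<kappa> N \<longleftrightarrow>
     (\<exists>x a. (\<forall>i<length Q. a i = (\<Sum>j<r. of_rat (Q ! i ! j) *\<^sub>R x j) \<and> N (a i) = 1) \<and>
       (\<forall>i<length Q. \<forall>j<length Q. i \<noteq> j \<longrightarrow> \<kappa> \<le> norm (a i) * norm (a j) - \<bar>a i \<bullet> a j\<bar>))"

text \<open>Adding $\delta|x|$ to $N$ makes its unit ball strictly convex in a quantitative way: the functional
  that supports the new ball at $p$ is a supporting functional of $N$ plus $\delta p$, and it can nearly
  attain the new norm only near the line of $p$. Compactness of the sphere leaves finitely many.\<close>

lemma finite_supporting_functionals:
  fixes N :: "real ^ 'n \<Rightarrow> real"
  assumes N: "is_norm N" and \<delta>: "0 < \<delta>" and \<tau>: "0 < \<tau>" "\<tau> < 1"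
  obtains F w where "finite F" "F \<subseteq> sphere 0 1"
    and "\<And>p x. p \<in> F \<Longrightarrow> \<bar>w p \<bullet> x\<bar> \<le> N x + \<delta> * \<bar>p \<bullet> x\<bar>"
    and "\<And>x. \<exists>p\<in>F. (1 - \<tau>) * (N x + \<delta> * norm x) \<le> \<bar>w p \<bullet> x\<bar>"
proof -
  have "\<forall>p. \<exists>u. u \<bullet> p = N p \<and> (\<forall>x. \<bar>u \<bullet> x\<bar> \<le> N x)"
    using norm_supporting_functional[OF N] by metis
  then obtain u where u: "\<And>p. u p \<bullet> p = N p" "\<And>p x. \<bar>u p \<bullet> x\<bar> \<le> N x"
    by metis
  define w where "w p = u p + \<delta> *\<^sub>R p" for p
  define U where "U p = {x. (1 - \<tau>) * (N x + \<delta> * norm x) < w p \<bullet> x}" for p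
  have "compact (sphere (0 :: real ^ 'n) 1)" by simp
  moreover have "open (U p)" for p
    unfolding U_def by (intro open_Collect_less continuous_intros is_norm_continuous_on[OF N])
  moreover have "sphere 0 1 \<subseteq> (\<Union>p\<in>sphere 0 1. U p)"
  proof
    fix p :: "real ^ 'n" assume p: "p \<in> sphere 0 1"
    have "w p \<bullet> p = N p + \<delta>"
      using p by (simp add: w_def inner_add_left u dot_square_norm)
    moreover have "(1 - \<tau>) * (N p + \<delta>) < 1 * (N p + \<delta>)"
      using \<tau> \<delta> is_normD(1)[OF N, of p] by (intro mult_strict_right_mono) auto
    ultimately have "p \<in> U p" using p by (simp add: U_def)
    with p show "p \<in> (\<Union>p\<in>sphere 0 1. U p)" by blast
  qed
  ultimately obtain F where F: "F \<subseteq> sphere 0 1" "finite F" "sphere 0 1 \<subseteq> (\<Union>p\<in>F. U p)"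
    by (rule compactE_image)
  show ?thesis
  proof (rule that[OF F(2,1)])
    show "\<bar>w p \<bullet> x\<bar> \<le> N x + \<delta> * \<bar>p \<bullet> x\<bar>" for p x
      using u(2)[of p x] \<delta> abs_triangle_ineq[of "u p \<bullet> x" "\<delta> * (p \<bullet> x)"]
      by (simp add: w_def inner_add_left abs_mult)
    show "\<exists>p\<in>F. (1 - \<tau>) * (N x + \<delta> * norm x) \<le> \<bar>w p \<bullet> x\<bar>" for x
    proof (cases "x = 0")
      case True
      have "axis undefined 1 \<in> sphere (0 :: real ^ 'n) 1" by simp
      then have "F \<noteq> {}" using F(3) by blast
      then show ?thesis using True by (auto simp: is_norm_zero[OF N])
    next
      case False
      define y where "y = x /\<^sub>R norm x"
      have xy: "x = norm x *\<^sub>R y" and "y \<in> sphere 0 1"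
        using False by (simp_all add: y_def)
      then obtain p where p: "p \<in> F" "y \<in> U p" using F(3) by blast
      then have "norm x * ((1 - \<tau>) * (N y + \<delta> * norm y)) < norm x * (w p \<bullet> y)"
        using False by (intro mult_strict_left_mono) (auto simp: U_def)
      moreover have "N x = norm x * N y"
        using xy is_normD(3)[OF N, of "norm x" y] by simp
      moreover have "w p \<bullet> x = norm x * (w p \<bullet> y)"
        using xy by (metis inner_scaleR_right)
      moreover have "norm y = 1" using \<open>y \<in> sphere 0 1\<close> by simp
      ultimately have "(1 - \<tau>) * (N x + \<delta> * norm x) < w p \<bullet> x"
        by (simp add: algebra_simps)
      then show ?thesis using p(1) by (intro bexI[of _ p]) auto
    qed
  qed
qed

lemma is_norm_Max_functionals:
  fixes w :: "'b \<Rightarrow> real ^ 'n"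
  assumes F: "finite F" "F \<noteq> {}" and t: "\<And>p. p \<in> F \<Longrightarrow> 0 < t p"
    and sep: "\<And>x. x \<noteq> 0 \<Longrightarrow> \<exists>p\<in>F. w p \<bullet> x \<noteq> 0"
  shows "is_norm (\<lambda>x. MAX p\<in>F. \<bar>w p \<bullet> x\<bar> / t p)"
proof -
  let ?N = "\<lambda>x. MAX p\<in>F. \<bar>w p \<bullet> x\<bar> / t p"
  have upper: "\<bar>w p \<bullet> x\<bar> / t p \<le> ?N x" if "p \<in> F" for p x
    using F that by (intro Max_ge) auto
  have attained: "\<exists>p\<in>F. ?N x = \<bar>w p \<bullet> x\<bar> / t p" for x
  proof -
    have "?N x \<in> (\<lambda>p. \<bar>w p \<bullet> x\<bar> / t p) ` F"
      using F by (intro Max_in) auto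
    then show ?thesis by blast
  qed
  have nonneg: "0 \<le> ?N x" for x
    using attained[of x] t by (fastforce intro: divide_nonneg_pos)
  show ?thesis
    unfolding is_norm_def
  proof (intro conjI allI)
    show "0 \<le> ?N x" for x by (rule nonneg)
    show "?N x = 0 \<longleftrightarrow> x = 0" for x
    proof
      assume "?N x = 0"
      then have "\<bar>w p \<bullet> x\<bar> / t p \<le> 0" if "p \<in> F" for p
        using upper[OF that, of x] by simp
      then have "w p \<bullet> x = 0" if "p \<in> F" for p
        using t[OF that] that by (force simp: divide_le_0_iff)
      then show "x = 0" using sep by blast
    next
      assume "x = 0"
      then show "?N x = 0" using F by simp
    qed
    show "?N (c *\<^sub>R x) = \<bar>c\<bar> * ?N x" for c x
    proof (rule antisym)
      obtain p where "p \<in> F" "?N (c *\<^sub>R x) = \<bar>w p \<bullet> (c *\<^sub>R x)\<bar> / t p"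
        using attained by blast
      then show "?N (c *\<^sub>R x) \<le> \<bar>c\<bar> * ?N x"
        using mult_left_mono[OF upper[of p x], of "\<bar>c\<bar>"] by (simp add: abs_mult)
      obtain p where "p \<in> F" "?N x = \<bar>w p \<bullet> x\<bar> / t p"
        using attained by blast
      then show "\<bar>c\<bar> * ?N x \<le> ?N (c *\<^sub>R x)"
        using upper[of p "c *\<^sub>R x"] by (simp add: abs_mult)
    qed
    show "?N (x + y) \<le> ?N x + ?N y" for x y
    proof -
      obtain p where p: "p \<in> F" "?N (x + y) = \<bar>w p \<bullet> (x + y)\<bar> / t p"
        using attained by blast
      have "\<bar>w p \<bullet> (x + y)\<bar> / t p \<le> \<bar>w p \<bullet> x\<bar> / t p + \<bar>w p \<bullet> y\<bar> / t p"
        using t[OF p(1)] unfolding add_divide_distrib[symmetric]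
        by (intro divide_right_mono) (auto simp: inner_add_right)
      then show ?thesis using p upper[OF p(1), of x] upper[OF p(1), of y] by linarith
    qed
  qed
qed

lemma uniform_margin:
  fixes S D :: "'b \<Rightarrow> real"
  assumes "finite \<Phi>" "\<And>z. z \<in> \<Phi> \<Longrightarrow> 0 < D z" "0 < \<epsilon>"
  obtains \<eta> where "0 < \<eta>" "\<eta> < \<epsilon>" "\<And>z. z \<in> \<Phi> \<Longrightarrow> \<eta> * S z < D z"
proof -
  have "\<forall>\<^sub>F \<eta> in at_right (0 :: real). \<eta> * S z < D z" if "z \<in> \<Phi>" for z
    using assms(2)[OF that] by (intro order_tendstoD(2)[of _ 0]) (auto intro!: tendsto_eq_intros)
  then have "\<forall>\<^sub>F \<eta> in at_right (0 :: real). \<forall>z\<in>\<Phi>. \<eta> * S z < D z"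
    using assms(1) by (intro eventually_ball_finite) auto
  then have "\<forall>\<^sub>F \<eta> in at_right (0 :: real). (\<forall>z\<in>\<Phi>. \<eta> * S z < D z) \<and> \<eta> \<in> {0<..<\<epsilon>}"
    using eventually_at_right_real[OF assms(3)] by eventually_elim auto
  then obtain \<eta> where "(\<forall>z\<in>\<Phi>. \<eta> * S z < D z) \<and> \<eta> \<in> {0<..<\<epsilon>}"
    using eventually_happens' trivial_limit_at_right_real by blast
  then show ?thesis using that by auto
qed

text \<open>The approximating ball is a polytope with small facets and generic distances of the facets from
  the origin. If vectors $a_i$ as in \<^const>\<open>over_dependent\<close> lie on its boundary, then no two of
  them lie on the same pair of opposite facets, because two points of such a pair are closer to parallel
  than $\kappa$ permits. Let $w_p$ be the functional that defines the facet of $p$ at height $t(p)$.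
  There are distinct $p_i$ with $w_{p_i} \cdot a_i = \pm t(p_i)$. As there are more than
  $dr$ linear forms $w_{p_i} \cdot a_i$ in $x$, some combination $\sum_i \nu_i w_{p_i} \cdot a_i$ vanishes
  identically, hence $\sum_i \pm \nu_i t(p_i) = 0$. There are only finitely many such relations
  and generic weights $t$ violate all of them, with a positive margin. The margin makes the
  argument robust under a small change of the norm.\<close>

lemma approximation_avoiding_over_dependence:
  fixes N :: "real ^ 'n \<Rightarrow> real"
  assumes N: "is_norm N" and \<zeta>: "0 < \<zeta>" "\<zeta> \<le> 1" and \<kappa>: "0 < \<kappa>"
    and Q: "CARD('n) * r < length Q"
  obtains N' \<eta> where "is_norm N'" "0 < \<eta>" "\<eta> < 1" "\<And>x. \<bar>N' x - N x\<bar> \<le> \<zeta> * N x"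
    and "\<And>M. (\<And>x. \<bar>N' x - M x\<bar> \<le> \<eta> * M x) \<Longrightarrow> \<not> over_dependent Q r \<kappa> M"
proof -
  define k where "k = length Q"
  obtain \<alpha> where \<alpha>: "0 < \<alpha>" "\<And>x. \<alpha> * norm x \<le> N x"
    using is_norm_lower_bound[OF N] by blast
  \<comment> \<open>\<open>\<delta>\<close> and the first bound on \<open>\<tau>\<close> keep the polytope within \<open>\<zeta>\<close> of the ball of \<open>N\<close>; the second
    bound on \<open>\<tau>\<close> makes the facets smaller than \<open>\<kappa>\<close>\<close>
  define \<delta> where "\<delta> = \<zeta> * \<alpha> / 4"
  define \<tau> where "\<tau> = min (\<zeta> / 4) (\<kappa> * \<delta> * \<alpha> / 256)"
  have \<delta>: "0 < \<delta>" using \<zeta> \<alpha> by (simp add: \<delta>_def)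
  have \<tau>: "0 < \<tau>" "\<tau> \<le> \<zeta> / 4" "\<tau> \<le> 1 / 4" "\<tau> \<le> \<kappa> * \<delta> * \<alpha> / 256" "\<tau> < 1"
    using \<zeta> \<kappa> \<delta> \<alpha> by (auto simp: \<tau>_def)
  define N1 where "N1 x = N x + \<delta> * norm x" for x
  have N1: "N x \<le> N1 x" "0 \<le> N1 x" "N1 x \<le> (1 + \<zeta> / 4) * N x" for x
  proof -
    have "0 \<le> \<delta> * norm x" using \<delta> by simp
    moreover have "\<delta> * norm x \<le> \<zeta> / 4 * N x"
      using mult_left_mono[OF \<alpha>(2)[of x], of "\<zeta> / 4"] \<zeta>(1) by (simp add: \<delta>_def)
    ultimately show "N x \<le> N1 x" "0 \<le> N1 x" "N1 x \<le> (1 + \<zeta> / 4) * N x"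
      using is_normD(1)[OF N, of x] by (simp_all add: N1_def algebra_simps)
  qed
  obtain F w where F: "finite F" "F \<subseteq> sphere 0 1"
    and w_le: "\<And>p x. p \<in> F \<Longrightarrow> \<bar>w p \<bullet> x\<bar> \<le> N x + \<delta> * \<bar>p \<bullet> x\<bar>"
    and w_ge: "\<And>x. \<exists>p\<in>F. (1 - \<tau>) * N1 x \<le> \<bar>w p \<bullet> x\<bar>"
    using finite_supporting_functionals[OF N \<delta> \<tau>(1) \<tau>(5)] unfolding N1_def by blast
  have "F \<noteq> {}" using w_ge by blast
  \<comment> \<open>all ways to assign distinct facets and signs to the vectors; the dependence \<open>\<nu>\<close> is determined by
    the facets alone, before the weights \<open>t\<close> are chosen\<close>
  define I where "I = {p \<in> {..<k} \<rightarrow>\<^sub>E F. inj_on p {..<k}}"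
  have "\<forall>p. \<exists>\<nu>. (\<exists>i<k. \<nu> i \<noteq> 0) \<and>
      (\<forall>j<r. (\<Sum>i<k. (\<nu> i * of_rat (Q ! i ! j)) *\<^sub>R w (p i)) = 0)"
    using vector_weights_annihilating[OF Q[folded k_def], of "\<lambda>i j. of_rat (Q ! i ! j)"]
    by (intro allI)
  from choice[OF this] obtain \<nu> where \<nu>_all: "\<forall>p. (\<exists>i<k. \<nu> p i \<noteq> 0) \<and>
      (\<forall>j<r. (\<Sum>i<k. (\<nu> p i * of_rat (Q ! i ! j)) *\<^sub>R w (p i)) = 0)"
    by (elim exE)
  have \<nu>_nz: "\<exists>i<k. \<nu> p i \<noteq> 0" for p
    by (rule conjunct1[OF spec[OF \<nu>_all]])
  have \<nu>: "(\<Sum>i<k. (\<nu> p i * of_rat (Q ! i ! j)) *\<^sub>R w (p i)) = 0" if "j < r" for p j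
    using conjunct2[OF spec[OF \<nu>_all, of p]] that by simp
  define \<Phi> where "\<Phi> = (\<lambda>(p, \<sigma>). (p, \<lambda>i. \<nu> p i * \<sigma> i)) ` (I \<times> ({..<k} \<rightarrow>\<^sub>E {1, - 1 :: real}))"
  have "finite \<Phi>"
    using F(1) by (auto simp: \<Phi>_def I_def intro!: finite_imageI finite_cartesian_product finite_PiE)
  have "\<exists>t. (\<forall>v\<in>F. 1 - \<tau> \<le> t v \<and> t v \<le> 1) \<and> (\<forall>(p, \<mu>)\<in>\<Phi>. (\<Sum>i<k. \<mu> i * t (p i)) \<noteq> 0)"
  proof (rule generic_weights[OF F(1) \<open>finite \<Phi>\<close> \<tau>(1)])
    show "\<tau> < 1" using \<tau>(3) by simp
    fix p \<mu> assume "(p, \<mu>) \<in> \<Phi>"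
    then obtain \<sigma> where \<sigma>: "p \<in> I" "\<sigma> \<in> {..<k} \<rightarrow>\<^sub>E {1, - 1}" "\<mu> = (\<lambda>i. \<nu> p i * \<sigma> i)"
      by (auto simp: \<Phi>_def)
    obtain i where "i < k" "\<nu> p i \<noteq> 0" using \<nu>_nz by blast
    moreover have "\<sigma> i \<noteq> 0" using PiE_mem[OF \<sigma>(2), of i] \<open>i < k\<close> by auto
    ultimately have "\<exists>i<k. \<mu> i \<noteq> 0" using \<sigma>(3) by auto
    then show "inj_on p {..<k} \<and> p ` {..<k} \<subseteq> F \<and> (\<exists>i<k. \<mu> i \<noteq> 0)"
      using \<sigma>(1) by (auto simp: I_def)
  qed blast
  then obtain t where t: "\<And>v. v \<in> F \<Longrightarrow> 1 - \<tau> \<le> t v" "\<And>v. v \<in> F \<Longrightarrow> t v \<le> 1"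
    and generic: "\<And>p \<mu>. (p, \<mu>) \<in> \<Phi> \<Longrightarrow> (\<Sum>i<k. \<mu> i * t (p i)) \<noteq> 0"
    by blast
  have t_pos: "0 < t v" if "v \<in> F" for v
    using t(1)[OF that] \<tau>(3) by linarith
  define N' where "N' x = (MAX p\<in>F. \<bar>w p \<bullet> x\<bar> / t p)" for x
  have N'_ge: "(1 - \<tau>) * N1 x \<le> N' x" for x
  proof -
    obtain p where p: "p \<in> F" "(1 - \<tau>) * N1 x \<le> \<bar>w p \<bullet> x\<bar>" using w_ge by blast
    note p(2)
    also have "\<bar>w p \<bullet> x\<bar> \<le> \<bar>w p \<bullet> x\<bar> / t p"
      using t(2)[OF p(1)] t_pos[OF p(1)] by (simp add: pos_le_divide_eq mult_left_le)
    also have "\<dots> \<le> N' x"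
      unfolding N'_def using F(1) p(1) by (intro Max_ge) auto
    finally show ?thesis .
  qed
  have attained: "\<exists>p\<in>F. \<bar>w p \<bullet> x\<bar> = t p * N' x" for x
  proof -
    obtain p where "p \<in> F" "N' x = \<bar>w p \<bullet> x\<bar> / t p"
    proof -
      have "N' x \<in> (\<lambda>p. \<bar>w p \<bullet> x\<bar> / t p) ` F"
        unfolding N'_def using F(1) \<open>F \<noteq> {}\<close> by (intro Max_in) auto
      then show ?thesis using that by blast
    qed
    then show ?thesis using t_pos[of p] by (intro bexI[of _ p]) auto
  qed
  have N'_le: "(1 - \<tau>) * N' x \<le> N1 x" for x
  proof -
    obtain p where p: "p \<in> F" "\<bar>w p \<bullet> x\<bar> = t p * N' x" using attained by blast
    have "0 \<le> (1 - \<tau>) * N1 x" using N1(2) \<tau>(5) by simp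
    then have "0 \<le> N' x" using N'_ge[of x] by linarith
    then have "(1 - \<tau>) * N' x \<le> t p * N' x"
      using t(1)[OF p(1)] by (intro mult_right_mono) auto
    moreover have "\<delta> * \<bar>p \<bullet> x\<bar> \<le> \<delta> * norm x"
      using \<delta> F(2) p(1) Cauchy_Schwarz_ineq2[of p x] by (intro mult_left_mono) auto
    ultimately show ?thesis using w_le[OF p(1), of x] p(2) by (simp add: N1_def)
  qed

  have norm_N': "is_norm N'"
    unfolding N'_def
  proof (rule is_norm_Max_functionals[OF F(1) \<open>F \<noteq> {}\<close> t_pos])
    fix x :: "real ^ 'n" assume "x \<noteq> 0"
    then have "0 < N x" using is_normD(1,2)[OF N, of x] by (auto simp: less_le)
    then have "0 < N1 x" using N1(1)[of x] by linarith
    then have "0 < (1 - \<tau>) * N1 x" using \<tau>(5) by simp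
    moreover obtain p where "p \<in> F" "(1 - \<tau>) * N1 x \<le> \<bar>w p \<bullet> x\<bar>" using w_ge by blast
    ultimately show "\<exists>p\<in>F. w p \<bullet> x \<noteq> 0" by (intro bexI[of _ p]) auto
  qed
  have close: "\<bar>N' x - N x\<bar> \<le> \<zeta> * N x" for x
  proof -
    have Nx: "0 \<le> N x" "0 \<le> N' x" using is_normD(1)[OF N] is_normD(1)[OF norm_N'] by auto
    have "(1 - \<zeta>) * N x \<le> (1 - \<tau>) * N1 x"
      using \<tau> \<zeta> N1(1)[of x] Nx by (intro mult_mono) auto
    then have "(1 - \<zeta>) * N x \<le> N' x" using N'_ge[of x] by linarith
    moreover have "N' x \<le> (1 + \<zeta>) * N x"
    proof -
      have "(1 - \<zeta> / 4) * N' x \<le> (1 - \<tau>) * N' x"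
        using \<tau>(2) Nx by (intro mult_right_mono) auto
      also have "\<dots> \<le> (1 + \<zeta> / 4) * N x"
        using N'_le[of x] N1(3)[of x] by linarith
      also have "\<dots> \<le> ((1 - \<zeta> / 4) * (1 + \<zeta>)) * N x"
      proof (rule mult_right_mono[OF _ Nx(1)])
        have "\<zeta> * \<zeta> \<le> 1 * \<zeta>" using \<zeta> by (intro mult_right_mono) auto
        moreover have "(1 - \<zeta> / 4) * (1 + \<zeta>) = 1 + 3 * \<zeta> / 4 - \<zeta> * \<zeta> / 4"
          by (simp add: distrib_left left_diff_distrib)
        ultimately show "1 + \<zeta> / 4 \<le> (1 - \<zeta> / 4) * (1 + \<zeta>)"
          using \<zeta> by linarith
      qed
      finally have "(1 - \<zeta> / 4) * N' x \<le> (1 - \<zeta> / 4) * ((1 + \<zeta>) * N x)"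
        by (simp only: mult.assoc)
      then show ?thesis using \<zeta> by (simp add: mult_le_cancel_left)
    qed
    ultimately show ?thesis by (simp add: abs_le_iff algebra_simps)
  qed
  have facet_small: "norm a * norm b - \<bar>a \<bullet> b\<bar> < \<kappa>"
    if p: "p \<in> F" "\<bar>w p \<bullet> a\<bar> = t p * N' a" "\<bar>w p \<bullet> b\<bar> = t p * N' b"
      and unit: "N' a \<le> 2" "N' b \<le> 2" for p a b
  proof -
    have dir: "norm x - \<bar>p \<bullet> x\<bar> \<le> 8 * \<tau> / \<delta>" and bound: "norm x \<le> 4 / \<alpha>"
      if x: "\<bar>w p \<bullet> x\<bar> = t p * N' x" "N' x \<le> 2" for x
    proof -
      have nn: "0 \<le> N' x" by (rule is_normD(1)[OF norm_N'])
      have "1 / 2 * N1 x \<le> (1 - \<tau>) * N1 x"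
        using \<tau>(3) N1(2) by (intro mult_right_mono) auto
      then have N1x: "N1 x \<le> 4" using N'_ge[of x] x(2) by linarith
      then have "\<alpha> * norm x \<le> 4" using \<alpha>(2)[of x] N1(1)[of x] by linarith
      then show "norm x \<le> 4 / \<alpha>" using \<alpha>(1) by (simp add: pos_le_divide_eq mult.commute)
      \<comment> \<open>on the facet of \<open>p\<close> the functional \<open>w p\<close> nearly attains \<open>N1\<close>, which forces \<open>x\<close> towards
        the line of \<open>p\<close>\<close>
      have "(1 - \<tau>) * ((1 - \<tau>) * N1 x) \<le> t p * N' x"
        using t(1)[OF p(1)] N'_ge[of x] \<tau>(5) N1(2)[of x] nn t_pos[OF p(1)]
        by (intro mult_mono) auto
      also have "\<dots> \<le> N x + \<delta> * \<bar>p \<bullet> x\<bar>"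
        using w_le[OF p(1), of x] x(1) by simp
      finally have "(1 - \<tau>) * ((1 - \<tau>) * N1 x) \<le> N x + \<delta> * \<bar>p \<bullet> x\<bar>" .
      moreover have "(1 - 2 * \<tau>) * N1 x \<le> ((1 - \<tau>) * (1 - \<tau>)) * N1 x"
        using N1(2) by (intro mult_right_mono) (auto simp: algebra_simps)
      moreover have "\<tau> * N1 x \<le> \<tau> * 4" using N1x \<tau>(1) by (intro mult_left_mono) auto
      ultimately have "\<delta> * (norm x - \<bar>p \<bullet> x\<bar>) \<le> 8 * \<tau>"
        by (simp add: N1_def algebra_simps)
      then show "norm x - \<bar>p \<bullet> x\<bar> \<le> 8 * \<tau> / \<delta>"
        using \<delta> by (simp add: pos_le_divide_eq mult.commute)
    qed
    have "norm a * norm b - \<bar>a \<bullet> b\<bar> \<le> 2 * (8 * \<tau> / \<delta>) * (norm a + norm b)"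
      using F(2) p unit by (intro nonparallelism_le_of_common_direction[of p] dir) auto
    also have "\<dots> \<le> 2 * (8 * \<tau> / \<delta>) * (4 / \<alpha> + 4 / \<alpha>)"
      using p unit \<tau>(1) \<delta> by (intro mult_left_mono add_mono bound) auto
    also have "\<dots> = 128 * \<tau> / (\<delta> * \<alpha>)" by simp
    also have "\<dots> \<le> 128 * (\<kappa> * \<delta> * \<alpha> / 256) / (\<delta> * \<alpha>)"
      using \<tau>(4) \<delta> \<alpha>(1) by (intro divide_right_mono mult_left_mono) auto
    also have "\<dots> = \<kappa> / 2" using \<delta> \<alpha>(1) by simp
    also have "\<dots> < \<kappa>" using \<kappa> by simp
    finally show ?thesis .
  qed
  obtain \<eta> where \<eta>: "0 < \<eta>" "\<eta> < 1"
    and margin: "\<And>z. z \<in> \<Phi> \<Longrightarrow> \<eta> * (\<Sum>i<k. \<bar>snd z i\<bar>) < \<bar>\<Sum>i<k. snd z i * t (fst z i)\<bar>"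
    by (rule uniform_margin[OF \<open>finite \<Phi>\<close>, of "\<lambda>z. \<bar>\<Sum>i<k. snd z i * t (fst z i)\<bar>" 1
          "\<lambda>z. \<Sum>i<k. \<bar>snd z i\<bar>"]) (use generic in auto)
  have "\<not> over_dependent Q r \<kappa> M" if M: "\<And>x. \<bar>N' x - M x\<bar> \<le> \<eta> * M x" for M
  proof
    assume "over_dependent Q r \<kappa> M"
    then obtain x a where comb: "\<forall>i<k. a i = (\<Sum>j<r. of_rat (Q ! i ! j) *\<^sub>R x j) \<and> M (a i) = 1"
      and sep: "\<forall>i<k. \<forall>j<k. i \<noteq> j \<longrightarrow> \<kappa> \<le> norm (a i) * norm (a j) - \<bar>a i \<bullet> a j\<bar>"
      unfolding over_dependent_def k_def by (elim exE conjE)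
    have a: "a i = (\<Sum>j<r. of_rat (Q ! i ! j) *\<^sub>R x j)" and unit: "M (a i) = 1" if "i < k" for i
      using comb that by blast+
    have N'a: "\<bar>1 - N' (a i)\<bar> \<le> \<eta>" if "i < k" for i
      using M[of "a i"] unit[OF that] by (simp add: abs_minus_commute)
    have "\<forall>i. \<exists>p. p \<in> F \<and> \<bar>w p \<bullet> a i\<bar> = t p * N' (a i)"
      using attained by blast
    then obtain p0 where p0: "\<And>i. p0 i \<in> F" "\<And>i. \<bar>w (p0 i) \<bullet> a i\<bar> = t (p0 i) * N' (a i)"
      by metis
    define p where "p = restrict p0 {..<k}"
    define \<sigma> where "\<sigma> = (\<lambda>i\<in>{..<k}. if w (p i) \<bullet> a i < 0 then - 1 else (1 :: real))"
    have p: "p i \<in> F" "\<bar>w (p i) \<bullet> a i\<bar> = t (p i) * N' (a i)" if "i < k" for i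
      using p0 that by (auto simp: p_def)
    have inj: "inj_on p {..<k}"
    proof (rule inj_onI, rule ccontr)
      fix i j assume ij: "i \<in> {..<k}" "j \<in> {..<k}" "p i = p j" "i \<noteq> j"
      have "N' (a i) \<le> 2" "N' (a j) \<le> 2"
        using N'a[of i] N'a[of j] ij \<eta>(2) by (auto simp: abs_le_iff)
      then have "norm (a i) * norm (a j) - \<bar>a i \<bullet> a j\<bar> < \<kappa>"
        using facet_small[of "p i" "a i" "a j"] p[of i] p[of j] ij by auto
      then show False using sep ij by force
    qed
    define \<mu> where "\<mu> i = \<nu> p i * \<sigma> i" for i
    have "p \<in> I" using p inj by (auto simp: I_def p_def)
    moreover have "\<sigma> \<in> {..<k} \<rightarrow>\<^sub>E {1, - 1}" by (auto simp: \<sigma>_def)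
    ultimately have mem: "(p, \<mu>) \<in> \<Phi>"
      unfolding \<Phi>_def \<mu>_def by force
    have "(\<Sum>i<k. \<mu> i * t (p i) * N' (a i)) = (\<Sum>i<k. \<nu> p i * (w (p i) \<bullet> a i))"
    proof (intro sum.cong refl)
      fix i assume "i \<in> {..<k}"
      then have "w (p i) \<bullet> a i = \<sigma> i * (t (p i) * N' (a i))"
        using p(2)[of i] by (auto simp: \<sigma>_def)
      then show "\<mu> i * t (p i) * N' (a i) = \<nu> p i * (w (p i) \<bullet> a i)"
        by (simp add: \<mu>_def)
    qed
    also have "\<dots> = (\<Sum>i<k. \<Sum>j<r. ((\<nu> p i * of_rat (Q ! i ! j)) *\<^sub>R w (p i)) \<bullet> x j)"
      by (intro sum.cong) (simp_all add: a inner_sum_right sum_distrib_left mult.assoc)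
    also have "\<dots> = (\<Sum>j<r. (\<Sum>i<k. (\<nu> p i * of_rat (Q ! i ! j)) *\<^sub>R w (p i)) \<bullet> x j)"
      unfolding inner_sum_left by (rule sum.swap)
    also have "\<dots> = 0" by (intro sum.neutral) (simp add: \<nu>)
    finally have zero: "(\<Sum>i<k. \<mu> i * t (p i) * N' (a i)) = 0" .
    have "\<bar>\<Sum>i<k. \<mu> i * t (p i)\<bar> = \<bar>\<Sum>i<k. \<mu> i * t (p i) * (1 - N' (a i))\<bar>"
      using zero by (simp add: right_diff_distrib sum_subtractf)
    also have "\<dots> \<le> (\<Sum>i<k. \<bar>\<mu> i * t (p i) * (1 - N' (a i))\<bar>)"
      by (rule sum_abs)
    also have "\<dots> \<le> (\<Sum>i<k. \<eta> * \<bar>\<mu> i\<bar>)"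
    proof (rule sum_mono)
      fix i assume "i \<in> {..<k}"
      then have i: "i < k" by simp
      have "\<bar>t (p i)\<bar> * \<bar>1 - N' (a i)\<bar> \<le> 1 * \<eta>"
        using t(2)[OF p(1)[OF i]] t_pos[OF p(1)[OF i]] N'a[OF i] by (intro mult_mono) auto
      then have "\<bar>\<mu> i\<bar> * (\<bar>t (p i)\<bar> * \<bar>1 - N' (a i)\<bar>) \<le> \<bar>\<mu> i\<bar> * \<eta>"
        by (intro mult_left_mono) auto
      then show "\<bar>\<mu> i * t (p i) * (1 - N' (a i))\<bar> \<le> \<eta> * \<bar>\<mu> i\<bar>"
        by (simp add: abs_mult mult.assoc mult.commute[of \<eta>])
    qed
    finally show False
      using margin[OF mem] by (simp add: sum_distrib_left)
  qed
  then show ?thesis by (rule that[OF norm_N' \<eta> close])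
qed

section \<open>Over-dependent norms form a meagre set\<close>

text \<open>An open set that contains no unit ball of a norm is already disjoint from the set in question.
  Otherwise, one such ball is approximated by a ball for which the condition fails robustly.\<close>

lemma nowhere_dense_over_dependent:
  assumes \<kappa>: "0 < \<kappa>" and Q: "CARD('n::finite) * r < length Q"
  shows "nowhere_dense_in body_topology
    (unit_ball ` {N :: real ^ 'n \<Rightarrow> real. is_norm N \<and> over_dependent Q r \<kappa> N})"
proof -
  interpret B: Metric_space "sym_bodies :: (real ^ 'n) set set" body_dist
    by (rule Metric_space_sym_bodies)
  let ?S = "unit_ball ` {N :: real ^ 'n \<Rightarrow> real. is_norm N \<and> over_dependent Q r \<kappa> N}"
  have "\<exists>V. openin B.mtopology V \<and> V \<noteq> {} \<and> V \<subseteq> U \<and> V \<inter> ?S = {}"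
    if U: "openin B.mtopology U" "U \<noteq> {}" for U
  proof (cases "U \<inter> unit_ball ` {N. is_norm N} = {}")
    case True
    then show ?thesis using U by (intro exI[of _ U]) blast
  next
    case False
    then obtain N where N: "is_norm N" "unit_ball N \<in> U" by blast
    obtain \<epsilon> where \<epsilon>: "0 < \<epsilon>" "B.mball (unit_ball N) \<epsilon> \<subseteq> U"
      using U(1) N(2) unfolding B.openin_mtopology by blast
    obtain \<alpha> where \<alpha>: "0 < \<alpha>" "\<And>x. \<alpha> * norm x \<le> N x"
      using is_norm_lower_bound[OF N(1)] by blast
    define \<zeta> where "\<zeta> = min (1 / 2) (\<epsilon> * \<alpha> / 4)"
    have \<zeta>: "0 < \<zeta>" "\<zeta> \<le> 1 / 2" "\<zeta> \<le> 1" "\<zeta> \<le> \<epsilon> * \<alpha> / 4"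
      using \<epsilon> \<alpha> by (auto simp: \<zeta>_def)
    obtain N' \<eta> where N': "is_norm N'" and \<eta>: "0 < \<eta>" "\<eta> < 1"
      and close: "\<And>x. \<bar>N' x - N x\<bar> \<le> \<zeta> * N x"
      and good: "\<And>M. (\<And>x. \<bar>N' x - M x\<bar> \<le> \<eta> * M x) \<Longrightarrow> \<not> over_dependent Q r \<kappa> M"
      using approximation_avoiding_over_dependence[OF N(1) \<zeta>(1,3) \<kappa> Q] by blast
    obtain \<beta> where \<beta>: "0 < \<beta>" "\<And>x. N' x \<le> \<beta> * norm x"
      using is_norm_upper_bound[OF N'] by blast
    note bodies = unit_ball_in_sym_bodies[OF N(1)] unit_ball_in_sym_bodies[OF N']
    have "2 * \<zeta> / \<alpha> \<le> \<epsilon> / 2"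
      using \<zeta>(4) \<alpha>(1) by (simp add: pos_divide_le_eq)
    then have "body_dist (unit_ball N) (unit_ball N') < \<epsilon>"
      using hausdorff_dist_unit_ball_le[OF N(1) N' \<alpha> _ \<zeta>(2) close] \<zeta>(1) \<epsilon>(1) bodies
      by (simp add: body_dist_def)
    then have "unit_ball N' \<in> U" using \<epsilon>(2) bodies by auto
    define V where "V = U \<inter> B.mball (unit_ball N') (\<eta> / \<beta>)"
    have "openin B.mtopology V" unfolding V_def using U(1) by blast
    moreover have "unit_ball N' \<in> V"
      using \<open>unit_ball N' \<in> U\<close> bodies(2) \<eta>(1) \<beta>(1) by (simp add: V_def)
    moreover have "V \<inter> ?S = {}"
    proof (rule ccontr)
      assume "V \<inter> ?S \<noteq> {}"
      then obtain M where M: "is_norm M" "over_dependent Q r \<kappa> M" "unit_ball M \<in> V" by blast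
      then have "hausdorff_dist (unit_ball N') (unit_ball M) \<le> \<eta> / \<beta>"
        using bodies(2) unit_ball_in_sym_bodies[OF M(1)] by (simp add: V_def body_dist_def)
      then have "\<bar>N' x - M x\<bar> \<le> \<eta> * M x" for x
        using norm_close_of_hausdorff_dist[OF N' M(1) \<beta>] \<eta> by simp
      then show False using good M(2) by blast
    qed
    ultimately show ?thesis by (intro exI[of _ V]) (auto simp: V_def)
  qed
  then show ?thesis
    unfolding nowhere_dense_in_def body_topology_def
    using unit_ball_in_sym_bodies by auto
qed

lemma nowhere_dense_in_subset:
  assumes "nowhere_dense_in X T" "S \<subseteq> T"
  shows "nowhere_dense_in X S"
proof -
  have "V \<inter> S = {}" if "V \<inter> T = {}" for V
    using that assms(2) by blast
  then show ?thesis
    using assms unfolding nowhere_dense_in_def by (meson order_trans)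
qed

lemma all_norms_besides_meagreI:
  fixes P :: "'b::countable \<Rightarrow> (real ^ 'n \<Rightarrow> real) \<Rightarrow> bool"
  assumes nd: "\<And>z. nowhere_dense_in body_topology (unit_ball ` {N. is_norm N \<and> P z N})"
    and Q: "\<And>N. is_norm N \<Longrightarrow> (\<And>z. \<not> P z N) \<Longrightarrow> Q N"
  shows "all_norms_besides_meagre Q"
proof -
  define S where "S = unit_ball ` {N. is_norm N \<and> \<not> Q N}"
  define T where "T z = S \<inter> unit_ball ` {N. is_norm N \<and> P z N}" for z
  have "nowhere_dense_in body_topology (T z)" for z
    by (rule nowhere_dense_in_subset[OF nd[of z]]) (simp add: T_def)
  moreover have "S = (\<Union>z. T z)"
    using Q by (fastforce simp: S_def T_def)
  ultimately show ?thesis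
    unfolding all_norms_besides_meagre_def meagre_in_def S_def[symmetric]
    by (intro exI[of _ "range T"]) auto
qed

section \<open>Counting unit distances\<close>

text \<open>Equality in the Cauchy-Schwarz inequality makes the vectors proportional, and vectors of equal
  norm are proportional only if they agree up to sign.\<close>

lemma nonparallel_unit_vectors:
  assumes N: "is_norm N" and "N a = 1" "N b = 1" "a \<noteq> b" "a \<noteq> - b"
  shows "0 < norm a * norm b - \<bar>a \<bullet> b\<bar>"
proof (rule ccontr)
  assume "\<not> ?thesis"
  then have "\<bar>a \<bullet> b\<bar> = norm a * norm b"
    using Cauchy_Schwarz_ineq2[of a b] by linarith
  then consider "norm a *\<^sub>R b = norm b *\<^sub>R a" | "norm a *\<^sub>R b = - norm b *\<^sub>R a"
    using norm_cauchy_schwarz_abs_eq by blast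
  then have par: "norm a *\<^sub>R b = norm b *\<^sub>R a \<or> norm a *\<^sub>R b = norm b *\<^sub>R (- a)"
    by cases auto
  have "N (norm a *\<^sub>R b) = norm a" "N (norm b *\<^sub>R a) = norm b" "N (norm b *\<^sub>R (- a)) = norm b"
    unfolding is_normD(3)[OF N] is_norm_minus[OF N] using assms by simp_all
  then have eq: "norm a = norm b" using par by metis
  have "norm a \<noteq> 0" using assms is_norm_zero[OF N] by auto
  then have "b = a \<or> b = - a"
    using par unfolding eq by (metis scaleR_cancel_left)
  then show False using assms by auto
qed

text \<open>Writing $A$ in terms of its rational basis $B$ would otherwise exhibit an excluded dependence
  with $r = |B|$; as $A$ is finite, some positive $\kappa$ bounds its non-parallelism from below.\<close>

lemma card_unit_vectors_le:
  fixes N :: "real ^ 'n \<Rightarrow> real"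
  assumes N: "is_norm N"
    and nondep: "\<And>Q r m. CARD('n) * r < length Q \<Longrightarrow> \<not> over_dependent Q r (1 / real (Suc m)) N"
    and A: "finite A" "\<And>a. a \<in> A \<Longrightarrow> N a = 1" "\<And>a. a \<in> A \<Longrightarrow> - a \<notin> A"
    and B: "B \<subseteq> A" "rat_vs.independent B" "A \<subseteq> rat_vs.span B"
  shows "card A \<le> CARD('n) * card B"
proof (rule ccontr)
  assume contra: "\<not> ?thesis"
  have finB: "finite B" using A(1) B(1) finite_subset by blast
  obtain a where a: "bij_betw a {..<card A} A"
    using ex_bij_betw_nat_finite[OF A(1)] by (auto simp: atLeast0LessThan)
  obtain x where x: "bij_betw x {..<card B} B"
    using ex_bij_betw_nat_finite[OF finB] by (auto simp: atLeast0LessThan)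
  have aA: "a i \<in> A" if "i < card A" for i using bij_betwE[OF a] that by auto
  define Q where
    "Q = map (\<lambda>i. map (\<lambda>j. rat_vs.representation B (a i) (x j)) [0..<card B]) [0..<card A]"
  have len: "length Q = card A" by (simp add: Q_def)
  have comb: "a i = (\<Sum>j<card B. of_rat (Q ! i ! j) *\<^sub>R x j)" if "i < card A" for i
  proof -
    have "a i = (\<Sum>b\<in>B. of_rat (rat_vs.representation B (a i) b) *\<^sub>R b)"
      using rat_vs.sum_representation_eq[OF B(2) _ finB order_refl] B(3) aA[OF that] by auto
    also have "\<dots> = (\<Sum>j<card B. of_rat (rat_vs.representation B (a i) (x j)) *\<^sub>R x j)"
      by (rule sum.reindex_bij_betw[OF x, symmetric])
    also have "\<dots> = (\<Sum>j<card B. of_rat (Q ! i ! j) *\<^sub>R x j)"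
      using that by (intro sum.cong) (auto simp: Q_def)
    finally show ?thesis .
  qed
  define \<Phi> where "\<Phi> = {(i, j). i < card A \<and> j < card A \<and> i \<noteq> j}"
  define s where "s z = norm (a (fst z)) * norm (a (snd z)) - \<bar>a (fst z) \<bullet> a (snd z)\<bar>" for z
  have fin: "finite \<Phi>"
    by (rule finite_subset[of _ "{..<card A} \<times> {..<card A}"]) (auto simp: \<Phi>_def)
  have pos: "0 < s z" if "z \<in> \<Phi>" for z
  proof -
    have z: "fst z < card A" "snd z < card A" "fst z \<noteq> snd z"
      using that by (auto simp: \<Phi>_def)
    have "a (fst z) \<noteq> a (snd z)" using z a by (auto simp: bij_betw_def inj_on_def)
    moreover have "a (fst z) \<noteq> - a (snd z)" using A(3)[of "a (snd z)"] aA z by metis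
    ultimately show ?thesis
      unfolding s_def using z by (intro nonparallel_unit_vectors[OF N] A(2) aA)
  qed
  have "\<exists>\<eta>>0. \<forall>z\<in>\<Phi>. \<eta> * 1 < s z"
  proof (rule uniform_margin[OF fin _ zero_less_one, where D = s and S = "\<lambda>_. 1"])
    show "0 < s z" if "z \<in> \<Phi>" for z using that by (rule pos)
  qed blast
  then obtain \<eta> where \<eta>: "0 < \<eta>" and margin: "\<forall>z\<in>\<Phi>. \<eta> * 1 < s z" by blast
  obtain m where m: "1 / real (Suc m) < \<eta>" using nat_approx_posE[OF \<eta>] by blast
  have sep: "1 / real (Suc m) \<le> norm (a i) * norm (a j) - \<bar>a i \<bullet> a j\<bar>"
    if "i < card A" "j < card A" "i \<noteq> j" for i j
    using bspec[OF margin, of "(i, j)"] m that by (simp add: \<Phi>_def s_def)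
  have "\<forall>i<card A. a i = (\<Sum>j<card B. of_rat (Q ! i ! j) *\<^sub>R x j) \<and> N (a i) = 1"
    by (intro allI impI conjI comb A(2) aA)
  moreover have "\<forall>i<card A. \<forall>j<card A. i \<noteq> j \<longrightarrow>
      1 / real (Suc m) \<le> norm (a i) * norm (a j) - \<bar>a i \<bullet> a j\<bar>"
    by (intro allI impI sep)
  ultimately have "over_dependent Q (card B) (1 / real (Suc m)) N"
    unfolding over_dependent_def len by (intro exI[of _ x] exI[of _ a] conjI)
  then show False using nondep[of "card B" Q m] contra len by simp
qed

text \<open>One vector is chosen from each pair $\pm u$ of unit difference vectors of $P$.\<close>

lemma unit_distances_le_sum_translations:
  fixes N :: "real ^ 'n \<Rightarrow> real"
  assumes N: "is_norm N" and P: "finite P"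
  obtains A where "finite A" "\<And>a. a \<in> A \<Longrightarrow> N a = 1" "\<And>a. a \<in> A \<Longrightarrow> - a \<notin> A"
    and "unit_distances N P \<le> (\<Sum>u\<in>A. card {p \<in> P. p + u \<in> P})"
proof -
  define D where "D = (\<lambda>(p, q). p - q) ` {(p, q) \<in> P \<times> P. N (p - q) = 1}"
  define rep where "rep u = (SOME v. v \<in> {u, - u})" for u :: "real ^ 'n"
  have rep: "rep u \<in> {u, - u}" for u
    unfolding rep_def by (rule someI[of _ u]) simp
  have rep_minus: "rep (- u) = rep u" for u
    unfolding rep_def by (simp add: insert_commute)
  define A where "A = rep ` D"
  define E where "E u = {p \<in> P. p + u \<in> P}" for u
  have "finite D"
    using P by (intro finite_surj[of "P \<times> P" D "\<lambda>(p, q). p - q"]) (auto simp: D_def)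
  then have finA: "finite A" by (simp add: A_def)
  have ND: "N u = 1" if "u \<in> D" for u using that by (auto simp: D_def)
  have unit: "N a = 1" if "a \<in> A" for a
  proof -
    obtain u where "u \<in> D" "a = rep u" using \<open>a \<in> A\<close> by (auto simp: A_def)
    then show ?thesis using rep[of u] ND[of u] is_norm_minus[OF N, of u] by auto
  qed
  have rep_A: "rep a = a" if "a \<in> A" for a
  proof -
    obtain u where "a = rep u" using \<open>a \<in> A\<close> by (auto simp: A_def)
    then show ?thesis using rep[of u] rep_minus[of u] by auto
  qed
  have anti: "- a \<notin> A" if "a \<in> A" for a
  proof
    assume "- a \<in> A"
    then have "- a = a" using rep_A[of "- a"] rep_A[OF \<open>a \<in> A\<close>] rep_minus[of a] by simp
    then have "2 *\<^sub>R a = 0" unfolding scaleR_2 by (metis add.right_inverse)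
    then have "a = 0" by simp
    then show False using unit[OF \<open>a \<in> A\<close>] is_norm_zero[OF N] by simp
  qed
  have "{{p, q} | p q. p \<in> P \<and> q \<in> P \<and> p \<noteq> q \<and> N (p - q) = 1}
      \<subseteq> (\<Union>u\<in>A. (\<lambda>p. {p, p + u}) ` E u)"
  proof clarify
    fix p q assume pq: "p \<in> P" "q \<in> P" "N (p - q) = 1"
    then have mem: "rep (p - q) \<in> A" by (auto simp: A_def D_def)
    show "{p, q} \<in> (\<Union>u\<in>A. (\<lambda>p. {p, p + u}) ` E u)"
    proof (cases "rep (p - q) = p - q")
      case True
      then have "{p, q} = {q, q + rep (p - q)}" "q \<in> E (rep (p - q))"
        using pq by (auto simp: E_def)
      then show ?thesis using mem by blast
    next
      case False
      then have "rep (p - q) = q - p" using rep[of "p - q"] by auto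
      then have "{p, q} = {p, p + rep (p - q)}" "p \<in> E (rep (p - q))"
        using pq by (auto simp: E_def)
      then show ?thesis using mem by blast
    qed
  qed
  then have "unit_distances N P \<le> card (\<Union>u\<in>A. (\<lambda>p. {p, p + u}) ` E u)"
    unfolding unit_distances_def using finA P by (intro card_mono) (auto simp: E_def)
  also have "\<dots> \<le> (\<Sum>u\<in>A. card ((\<lambda>p. {p, p + u}) ` E u))"
    by (rule card_UN_le[OF finA])
  also have "\<dots> \<le> (\<Sum>u\<in>A. card (E u))"
    using P by (intro sum_mono card_image_le) (simp add: E_def)
  finally show ?thesis
    unfolding E_def by (intro that[of A] finA unit anti)
qed

text \<open>The weight of a direction is its number of edges. A greedy basis $B$ carries at least the
  fraction $1/d$ of the total weight, and its edges are bounded by the grid inequality.\<close>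

lemma unit_distances_le:
  fixes N :: "real ^ 'n \<Rightarrow> real"
  assumes N: "is_norm N"
    and nondep: "\<And>Q r m. CARD('n) * r < length Q \<Longrightarrow> \<not> over_dependent Q r (1 / real (Suc m)) N"
    and P: "finite P" "P \<noteq> {}"
  shows "real (unit_distances N P) \<le> real CARD('n) / 2 * real (card P) * log 2 (real (card P))"
proof -
  obtain A where A: "finite A" "\<And>a. a \<in> A \<Longrightarrow> N a = 1" "\<And>a. a \<in> A \<Longrightarrow> - a \<notin> A"
    and le: "unit_distances N P \<le> (\<Sum>u\<in>A. card {p \<in> P. p + u \<in> P})"
    using unit_distances_le_sum_translations[OF N P(1)] by blast
  have "card A' \<le> CARD('n) * card B"
    if "A' \<subseteq> A" "B \<subseteq> A'" "rat_vs.independent B" "A' \<subseteq> rat_vs.span B" for A' B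
  proof (rule card_unit_vectors_le[OF N nondep])
    show "finite A'" using A(1) that(1) finite_subset by blast
  qed (use A that in auto)
  then obtain B where B: "B \<subseteq> A" "rat_vs.independent B"
    and greedy: "(\<Sum>u\<in>A. card {p \<in> P. p + u \<in> P}) \<le> CARD('n) * (\<Sum>u\<in>B. card {p \<in> P. p + u \<in> P})"
    using rat_vs.greedy_independent_subset[OF A(1), of "CARD('n)" "\<lambda>u. card {p \<in> P. p + u \<in> P}"]
    by blast
  have "finite B" using A(1) B(1) finite_subset by blast
  then have "real (\<Sum>u\<in>B. card {p \<in> P. p + u \<in> P}) \<le> real (card P) / 2 * log 2 (real (card P))"
    by (rule sum_edges_rat_independent_le[OF _ B(2) P])
  then have bound: "real CARD('n) * real (\<Sum>u\<in>B. card {p \<in> P. p + u \<in> P})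
      \<le> real CARD('n) * (real (card P) / 2 * log 2 (real (card P)))"
    by (rule mult_left_mono) simp
  have "real (unit_distances N P) \<le> real CARD('n) * real (\<Sum>u\<in>B. card {p \<in> P. p + u \<in> P})"
    using le greedy unfolding of_nat_mult[symmetric] of_nat_le_iff by linarith
  from order_trans[OF this bound] show ?thesis by simp
qed

theorem theorem1p1:
  assumes "CARD('n::finite) \<ge> 2"
  shows "all_norms_besides_meagre (\<lambda>N :: real ^ 'n \<Rightarrow> real.
           \<forall>n\<ge>1. \<forall>P. finite P \<and> card P = n \<longrightarrow>
             real (unit_distances N P) \<le> real CARD('n) / 2 * real n * log 2 (real n)) \<and>
         all_norms_besides_meagre (\<lambda>N :: real ^ 'n \<Rightarrow> real.
           \<forall>n\<ge>1. real (max_unit_distances N n) \<le> real CARD('n) / 2 * real n * log 2 (real n))"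
proof -
  have "all_norms_besides_meagre (\<lambda>N :: real ^ 'n \<Rightarrow> real.
           \<forall>n\<ge>1. \<forall>P. finite P \<and> card P = n \<longrightarrow>
             real (unit_distances N P) \<le> real CARD('n) / 2 * real n * log 2 (real n))"
  proof (rule all_norms_besides_meagreI[where P = "\<lambda>(Q, r, m) N.
        CARD('n) * r < length Q \<and> over_dependent Q r (1 / real (Suc m)) N"])
    fix z :: "rat list list \<times> nat \<times> nat"
    obtain Q r m where z: "z = (Q, r, m)" by (cases z)
    have "nowhere_dense_in body_topology ({} :: (real ^ 'n) set set)"
      unfolding nowhere_dense_in_def by blast
    then show "nowhere_dense_in body_topology (unit_ball ` {N :: real ^ 'n \<Rightarrow> real. is_norm N \<and>
        (case z of (Q, r, m) \<Rightarrow> \<lambda>N. CARD('n) * r < length Q \<and>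
          over_dependent Q r (1 / real (Suc m)) N) N})"
      using nowhere_dense_over_dependent[of "1 / real (Suc m)" r Q, where 'n = 'n]
      by (cases "CARD('n) * r < length Q") (auto simp: z)
  next
    fix N :: "real ^ 'n \<Rightarrow> real"
    assume N: "is_norm N" and nondep: "\<And>z. \<not> (case z of (Q, r, m) \<Rightarrow> \<lambda>N.
        CARD('n) * r < length Q \<and> over_dependent Q r (1 / real (Suc m)) N) N"
    have few: "\<not> over_dependent Q r (1 / real (Suc m)) N" if "CARD('n) * r < length Q" for Q r m
      using nondep[of "(Q, r, m)"] that by simp
    show "\<forall>n\<ge>1. \<forall>P. finite P \<and> card P = n \<longrightarrow>
        real (unit_distances N P) \<le> real CARD('n) / 2 * real n * log 2 (real n)"
    proof (intro allI impI)
      fix n and P :: "(real ^ 'n) set" assume n: "1 \<le> n" and P: "finite P \<and> card P = n"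
      then have "P \<noteq> {}" by auto
      then have "real (unit_distances N P) \<le> real CARD('n) / 2 * real (card P) * log 2 (real (card P))"
        using unit_distances_le[OF N few] P by blast
      then show "real (unit_distances N P) \<le> real CARD('n) / 2 * real n * log 2 (real n)"
        using P by simp
    qed
  qed
  then show ?thesis by (simp only: max_unit_distances_le_iff simp_thms)
qed

end
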